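(* Let $(\Sigma,m)$ be a weighted simplicial complex with coboundary operator $\delta$ and boundary operator $\partial$, and let $\rho\in\Sigma$. Then the following are equivalent: (i) $\partial\partial\omega(\rho)=0$ for all $\omega\in D(\partial\partial)\cap\ell^2(\Sigma,m)$. (ii) All connected components of the graph $b_\rho$ over $\mathrm{lk}(\rho)$ are recurrent.
   Context: Weighted simplicial complexes. Let $X$ be a set (of vertices). A simplicial complex $\hat\Sigma$ over $X$ is a (non-empty) set of finite subsets of $X$ closed under taking subsets, whose $0$-simplices are identified with $X$; it contains $\varnothing$. A simplex with $k+1$ elements has dimension $k$. Write $\tau\prec\sigma$ (or $\sigma\succ\tau$) if $\tau\subseteq\sigma$ and $|\sigma\setminus\tau|=1$; then $\tau$ is a face of $\sigma$ and $\sigma$ a coface of $\tau$. Let $m:\hat\Sigma\to(0,\infty)$. Put $\Sigma=\hat\Sigma$ if $\sum_{x\in X}m(x)<\infty$ and $\Sigma=\hat\Sigma\setminus\{\varnothing\}$ otherwise. Assume $m$ is locally summable: $\sum_{\sigma\succ\tau}m(\sigma)<\infty$ for all $\tau\in\Sigma$. Then $(\Sigma,m)$ is called a weighted simplicial complex; no local finiteness is assumed. All simplices below range over $\Sigma$. $C(\Sigma)$ denotes the complex functions on $\Sigma$ and $\ell^2=\ell^2(\Sigma,m)=\{\omega\in C(\Sigma):\sum_{\tau\in\Sigma} m(\tau)|\omega(\tau)|^2<\infty\}$. Coboundary and boundary. Fix a coboundary operator, i.e. a linear operator $\delta:C(\Sigma)\to C(\Sigma)$ of the form $\delta\omega(\sigma)=\sum_{\tau\prec\sigma}\theta(\tau,\sigma)\omega(\tau)$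 (a finite sum) with $\theta(\tau,\sigma)=\delta 1_\tau(\sigma)\in\{\pm1\}$ for $\tau\prec\sigma$, satisfying $\delta\delta=0$. The boundary operator $\partial:D(\partial)\to C(\Sigma)$ is $$\partial\omega(\rho)=\frac1{m(\rho)}\sum_{\tau\succ\rho}m(\tau)\theta(\rho,\tau)\omega(\tau),\qquad D(\partial)=\Big\{\omega\in C(\Sigma):\sum_{\tau\succ\rho}m(\tau)|\omega(\tau)|<\infty\text{ for all }\rho\in\Sigma\Big\}.$$ One has $\ell^2\subseteq D(\partial)$. Further $D(\partial\partial)=\{\omega\in D(\partial):\partial\omega\in D(\partial)\}$. Links. For $\rho\in\Sigma$, $\mathrm{lk}(\rho)=\{v\in X: v\cup\rho\in\Sigma,\ v\cup\rho\succ\rho\}$ (identifying the vertex $v$ with $\{v\}$), with $v\rho=v\cup\rho$ and $vv'\rho=v\cup v'\cup\rho$. The link graph is the symmetric function $b_\rho:\mathrm{lk}(\rho)\times\mathrm{lk}(\rho)\to[0,\infty)$, $b_\rho(v,v')=m(vv'\rho)$ if $v\ne v'$ and $vv'\rho\in\Sigma$, and $b_\rho(v,v')=0$ otherwise. Local summability gives $\sum_{v'}b_\rho(v,v')<\infty$ for all $v\in\mathrm{lk}(\rho)$. Connected components are the classes of vertices joined by finite paths along which $b_\rho>0$. Recurrence. A connected graph $b$ over $X$ is recurrent if the Markov chain $(Y_n)$ with transition probabilities $\mathbb P(Y_n=y\mid Y_{n-1}=x)=b(x,y)/\sum_z b(x,z)$ satisfies $\mathbb P(Y_k=y\text{ for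 some }k>0\mid Y_0=x)=1$ for all $x,y$; equivalently, the constant function $1$ is a pointwise limit of finitely supported functions $\varphi_n$ with $\frac12\sum_{x,y}b(x,y)|\varphi_n(x)-\varphi_n(y)|^2\to0$. A component consisting of a single vertex counts as recurrent. Connected graphs that are not recurrent are called transient. *)

theory Defs
  imports "HOL-Probability.Probability"
begin

section \<open>Weighted simplicial complexes\<close>

definition simplicial_complex :: "'a set \<Rightarrow> 'a set set \<Rightarrow> bool" where
  "simplicial_complex X S \<longleftrightarrow>
     S \<noteq> {} \<and> (\<forall>\<sigma>\<in>S. finite \<sigma>) \<and> (\<forall>\<sigma>\<in>S. \<forall>\<tau>. \<tau> \<subseteq> \<sigma> \<longrightarrow> \<tau> \<in> S) \<and>
     {x. {x} \<in> S} = X"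

definition is_face :: "'a set \<Rightarrow> 'a set \<Rightarrow> bool" where
  "is_face \<tau> \<sigma> \<longleftrightarrow> \<tau> \<subseteq> \<sigma> \<and> card (\<sigma> - \<tau>) = 1"

text \<open>The set \<open>\<Sigma>\<close> obtained from the full complex \<open>S\<close> (there written with a hat): the empty
  simplex is kept exactly if the vertices have finite total weight. For positive functions,
  summability in the sense of \<open>summable_on\<close> means that the sum is finite.\<close>

definition simplices :: "'a set \<Rightarrow> 'a set set \<Rightarrow> ('a set \<Rightarrow> real) \<Rightarrow> 'a set set" where
  "simplices X S m = (if (\<lambda>x. m {x}) summable_on X then S else S - {{}})"

definition weighted_simplicial_complex ::
    "'a set \<Rightarrow> 'a set set \<Rightarrow> ('a set \<Rightarrow> real) \<Rightarrow> bool" where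
  "weighted_simplicial_complex X S m \<longleftrightarrow>
     simplicial_complex X S \<and> (\<forall>\<sigma>\<in>S. m \<sigma> > 0) \<and>
     (\<forall>\<tau>\<in>simplices X S m. m summable_on {\<sigma>\<in>simplices X S m. is_face \<tau> \<sigma>})"

section \<open>Coboundary and boundary\<close>

text \<open>A function on \<open>\<Sigma>\<close> is represented by a total function on sets; all notions below depend
  only on its values on \<open>\<Sigma>\<close>. In particular, linearity of \<open>\<delta>\<close> on functions on \<open>\<Sigma>\<close> is
  contained in the required form.\<close>

definition theta :: "(('a set \<Rightarrow> complex) \<Rightarrow> 'a set \<Rightarrow> complex) \<Rightarrow> 'a set \<Rightarrow> 'a set \<Rightarrow> complex" where
  "theta \<delta> \<tau> \<sigma> = \<delta> (indicator {\<tau>}) \<sigma>"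

definition coboundary_operator ::
    "'a set set \<Rightarrow> (('a set \<Rightarrow> complex) \<Rightarrow> 'a set \<Rightarrow> complex) \<Rightarrow> bool" where
  "coboundary_operator \<Sigma> \<delta> \<longleftrightarrow>
     (\<forall>\<omega>. \<forall>\<sigma>\<in>\<Sigma>. \<delta> \<omega> \<sigma> = (\<Sum>\<tau> | \<tau> \<in> \<Sigma> \<and> is_face \<tau> \<sigma>. theta \<delta> \<tau> \<sigma> * \<omega> \<tau>)) \<and>
     (\<forall>\<tau>\<in>\<Sigma>. \<forall>\<sigma>\<in>\<Sigma>. is_face \<tau> \<sigma> \<longrightarrow> theta \<delta> \<tau> \<sigma> \<in> {1, -1}) \<and>
     (\<forall>\<omega>. \<forall>\<sigma>\<in>\<Sigma>. \<delta> (\<delta> \<omega>) \<sigma> = 0)"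

definition ell2 :: "'a set set \<Rightarrow> ('a set \<Rightarrow> real) \<Rightarrow> ('a set \<Rightarrow> complex) set" where
  "ell2 \<Sigma> m = {\<omega>. (\<lambda>\<tau>. m \<tau> * (cmod (\<omega> \<tau>))\<^sup>2) summable_on \<Sigma>}"

definition dom_boundary :: "'a set set \<Rightarrow> ('a set \<Rightarrow> real) \<Rightarrow> ('a set \<Rightarrow> complex) set" where
  "dom_boundary \<Sigma> m =
     {\<omega>. \<forall>\<rho>\<in>\<Sigma>. (\<lambda>\<tau>. m \<tau> * cmod (\<omega> \<tau>)) summable_on {\<tau>\<in>\<Sigma>. is_face \<rho> \<tau>}}"

definition boundary ::
    "'a set set \<Rightarrow> ('a set \<Rightarrow> real) \<Rightarrow> (('a set \<Rightarrow> complex) \<Rightarrow> 'a set \<Rightarrow> complex) \<Rightarrow>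
     ('a set \<Rightarrow> complex) \<Rightarrow> 'a set \<Rightarrow> complex" where
  "boundary \<Sigma> m \<delta> \<omega> \<rho> =
     1 / of_real (m \<rho>) *
       (\<Sum>\<^sub>\<infinity>\<tau>\<in>{\<tau>\<in>\<Sigma>. is_face \<rho> \<tau>}. of_real (m \<tau>) * theta \<delta> \<rho> \<tau> * \<omega> \<tau>)"

definition dom_boundary2 ::
    "'a set set \<Rightarrow> ('a set \<Rightarrow> real) \<Rightarrow> (('a set \<Rightarrow> complex) \<Rightarrow> 'a set \<Rightarrow> complex) \<Rightarrow>
     ('a set \<Rightarrow> complex) set" where
  "dom_boundary2 \<Sigma> m \<delta> =
     {\<omega> \<in> dom_boundary \<Sigma> m. boundary \<Sigma> m \<delta> \<omega> \<in> dom_boundary \<Sigma> m}"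

section \<open>Link graphs\<close>

definition link :: "'a set \<Rightarrow> 'a set set \<Rightarrow> 'a set \<Rightarrow> 'a set" where
  "link X \<Sigma> \<rho> = {v\<in>X. {v} \<union> \<rho> \<in> \<Sigma> \<and> is_face \<rho> ({v} \<union> \<rho>)}"

definition link_graph ::
    "'a set set \<Rightarrow> ('a set \<Rightarrow> real) \<Rightarrow> 'a set \<Rightarrow> 'a \<Rightarrow> 'a \<Rightarrow> real" where
  "link_graph \<Sigma> m \<rho> v v' =
     (if v \<noteq> v' \<and> {v} \<union> {v'} \<union> \<rho> \<in> \<Sigma> then m ({v} \<union> {v'} \<union> \<rho>) else 0)"

section \<open>Components and recurrence of weighted graphs\<close>

definition connected_components_of_graph :: "'a set \<Rightarrow> ('a \<Rightarrow> 'a \<Rightarrow> real) \<Rightarrow> 'a set set" where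
  "connected_components_of_graph V b =
     (\<lambda>v. {w. (\<lambda>x y. x \<in> V \<and> y \<in> V \<and> b x y > 0)\<^sup>*\<^sup>* v w}) ` V"

definition transition_probability :: "'a set \<Rightarrow> ('a \<Rightarrow> 'a \<Rightarrow> real) \<Rightarrow> 'a \<Rightarrow> 'a \<Rightarrow> real" where
  "transition_probability V b x y = b x y / (\<Sum>\<^sub>\<infinity>z\<in>V. b x z)"

definition markov_chain ::
    "'a set \<Rightarrow> ('a \<Rightarrow> 'a \<Rightarrow> real) \<Rightarrow> 'w measure \<Rightarrow> (nat \<Rightarrow> 'w \<Rightarrow> 'a) \<Rightarrow> bool" where
  "markov_chain V p M Y \<longleftrightarrow>
     prob_space M \<and>
     (\<forall>n. Y n \<in> measurable M (count_space V)) \<and>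
     (\<forall>n x. (\<forall>k\<le>Suc n. x k \<in> V) \<longrightarrow> \<P>(\<omega> in M. \<forall>k\<le>n. Y k \<omega> = x k) > 0 \<longrightarrow>
        \<P>(\<omega> in M. Y (Suc n) \<omega> = x (Suc n) \<bar> \<forall>k\<le>n. Y k \<omega> = x k) = p (x n) (x (Suc n)))"

text \<open>The chain is realised on a probability space whose points are trajectories, which is no
  restriction. Its law given \<open>Y 0 = x\<close> is determined by the transition probabilities, so the
  conditional probability below does not depend on the chosen realisation; the existential
  quantifier avoids any appeal to an existence theorem for Markov chains. For a single vertex
  without a loop the transition probabilities are undefined, hence the separate convention.\<close>

definition recurrent_graph :: "'a set \<Rightarrow> ('a \<Rightarrow> 'a \<Rightarrow> real) \<Rightarrow> bool" where
  "recurrent_graph V b \<longleftrightarrow>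
     (\<exists>v. V = {v}) \<or>
     (\<forall>x\<in>V. \<forall>y\<in>V. \<exists>(M :: (nat \<Rightarrow> 'a) measure) Y.
        markov_chain V (transition_probability V b) M Y \<and>
        \<P>(\<omega> in M. Y 0 \<omega> = x) > 0 \<and>
        \<P>(\<omega> in M. (\<exists>k>0. Y k \<omega> = y) \<bar> Y 0 \<omega> = x) = 1)"

end

theory Submission
  imports Defs
begin

text \<open>Write \<open>v\<rho>\<close> for \<open>insert v \<rho>\<close> and \<open>vw\<rho>\<close> for \<open>insert v (insert w \<rho>)\<close>. To a function \<open>\<omega>\<close>
  belongs the function \<open>\<psi>(v, w) = \<theta>(\<rho>, v\<rho>) \<theta>(v\<rho>, vw\<rho>) \<omega>(vw\<rho>)\<close> on the edges of the link
  graph \<open>b\<close>. The relation \<open>\<delta>\<delta> = 0\<close> makes \<open>\<psi>\<close> antisymmetric, so \<open>\<psi>\<close> is a flow.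
  Membership of \<open>\<omega>\<close> in \<open>\<ell>\<^sup>2\<close> gives \<open>\<psi>\<close> finite energy \<open>\<Sum> b |\<psi>|\<^sup>2\<close>, and
  \<open>m(\<rho>) \<partial>\<partial>\<omega>(\<rho>)\<close> is the total divergence \<open>\<Sum>\<^sub>v \<Sum>\<^sub>w b(v, w) \<psi>(v, w)\<close> (\<open>boundary_boundary_eq\<close>).
  The theorem thus rests on a classical fact of potential theory: a connected graph is recurrent
  iff every flow of finite energy with summable divergence has total divergence zero.

  This fact is derived from one family of functions. Fix a vertex \<open>y\<close>, let \<open>a\<^sub>n(x)\<close> be the
  probability that the walk from \<open>x\<close> avoids \<open>y\<close> at the times \<open>0, \<dots>, n\<close>, let \<open>P\<close> be the
  transition operator and \<open>d\<close> the vertex degree. The functions \<open>f\<^sub>n = 1 - a\<^sub>n\<close> need not have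
  finite support, but reversibility of the walk makes them summable with respect to \<open>d\<close>, and
  their energy is at most \<open>2 d(y) (P a\<^sub>n)(y)\<close> (\<open>hit_energy\<close>). The number \<open>(P a\<^sub>n)(x)\<close> is the
  probability that the walk started at \<open>x\<close> avoids \<open>y\<close> at the times \<open>1, \<dots>, n + 1\<close>, so
  recurrence means that it tends to \<open>0\<close> for all \<open>x\<close> and \<open>y\<close>.

  If it does, then \<open>f\<^sub>n\<close> tends to \<open>1\<close> with energies tending to \<open>0\<close>; Green's formula bounds
  \<open>\<Sum> f\<^sub>n div \<psi>\<close> by the energies of \<open>f\<^sub>n\<close> and \<open>\<psi>\<close>, and dominated convergence gives
  \<open>\<Sum> div \<psi> = 0\<close> (\<open>vanishing_avoidance_imp_flow_balanced\<close>). If it does not, then the same energy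
  bound and Fatou's lemma show that \<open>q = lim a\<^sub>n\<close> has finite energy; \<open>q\<close> is harmonic except at
  \<open>y\<close>, so the flow \<open>q(v) - q(w)\<close> has its whole divergence at \<open>y\<close>, where it is nonzero by
  connectedness (\<open>persistent_avoidance_imp_potential\<close>). This flow comes from \<open>\<omega> = \<delta>\<eta>\<close> with
  \<open>\<eta>(v\<rho>) = \<theta>(\<rho>, v\<rho>) q(v)\<close>, and what remains is that \<open>\<omega>\<close> lies in the domain of \<open>\<partial>\<partial>\<close> at
  all simplices, not only at \<open>\<rho>\<close> (\<open>triangle_support_dom_boundary2\<close>).

  Recurrence is stated through some Markov chain on some probability space. That the law of a
  given chain is expressed by the \<open>a\<^sub>n\<close> is \<open>return_prob_eq_1_iff\<close>; that a chain exists, without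
  which failure of recurrence would carry no information, is \<open>markov_chain_exists\<close>.\<close>

section \<open>Infinite sums\<close>

lemma has_sum_diff:
  fixes f g :: "'b \<Rightarrow> real"
  assumes "(f has_sum s) A" "(g has_sum t) A"
  shows "((\<lambda>x. f x - g x) has_sum (s - t)) A"
  using has_sum_add[OF assms(1) has_sum_uminusI[OF assms(2)]] by simp

lemma summable_on_diff:
  fixes f g :: "'b \<Rightarrow> real"
  assumes "f summable_on A" "g summable_on A"
  shows "(\<lambda>x. f x - g x) summable_on A"
  using assms has_sum_diff unfolding summable_on_def by blast

text \<open>Dominated convergence with respect to counting measure.\<close>

lemma infsum_tendsto_dominated:
  fixes f :: "nat \<Rightarrow> 'b \<Rightarrow> 'c::{banach, second_countable_topology}"
  assumes lim: "\<And>x. x \<in> A \<Longrightarrow> (\<lambda>n. f n x) \<longlonglongrightarrow> g x"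
    and bound: "\<And>n x. x \<in> A \<Longrightarrow> norm (f n x) \<le> h x"
    and h: "h summable_on A"
  shows "(\<lambda>n. infsum (f n) A) \<longlonglongrightarrow> infsum g A"
proof -
  have h_nonneg: "0 \<le> h x" if "x \<in> A" for x
    using bound[OF that, of 0] norm_ge_zero order_trans by blast
  have f_abs: "(\<lambda>x. norm (f n x)) summable_on A" for n
    using h bound by (rule summable_on_comparison_test) auto
  have g_bound: "norm (g x) \<le> h x" if "x \<in> A" for x
    using Lim_bounded[OF tendsto_norm[OF lim[OF that]]] bound[OF that] by blast
  have g_abs: "(\<lambda>x. norm (g x)) summable_on A"
    using h g_bound by (rule summable_on_comparison_test) auto
  have h_int: "integrable (count_space A) h"
    using h abs_summable_equivalent[of h A] summable_on_iff_abs_summable_on_real[of h A]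
    unfolding abs_summable_on_def by blast
  have "(\<lambda>n. integral\<^sup>L (count_space A) (f n)) \<longlonglongrightarrow> integral\<^sup>L (count_space A) g"
    by (rule integral_dominated_convergence[OF _ _ h_int]) (use lim bound in auto)
  moreover have "integral\<^sup>L (count_space A) (f n) = infsum (f n) A" for n
    using infsetsum_infsum abs_summable_equivalent f_abs unfolding infsetsum_def by metis
  moreover have "integral\<^sup>L (count_space A) g = infsum g A"
    using infsetsum_infsum abs_summable_equivalent g_abs unfolding infsetsum_def by metis
  ultimately show ?thesis by simp
qed

text \<open>Each value of \<open>f\<close> is taken at most \<open>N\<close> times by \<open>f \<circ> g\<close>, so finite partial sums are bounded
  by \<open>N\<close> times the sum of \<open>f\<close>. For the map from edges of the link graph to
  simplices, the fibres consist of the two orientations of an edge.\<close>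

lemma summable_on_compose_finite_fibres:
  fixes f :: "'b \<Rightarrow> real"
  assumes f: "f summable_on B" "\<And>y. y \<in> B \<Longrightarrow> 0 \<le> f y"
    and g: "g \<in> A \<rightarrow> B"
    and fibre: "\<And>y. y \<in> B \<Longrightarrow> finite {x\<in>A. g x = y} \<and> card {x\<in>A. g x = y} \<le> N"
  shows "(\<lambda>x. f (g x)) summable_on A"
proof (rule nonneg_bdd_above_summable_on)
  show "0 \<le> f (g x)" if "x \<in> A" for x using that f g by auto
  have "(\<Sum>x\<in>F. f (g x)) \<le> real N * infsum f B" if F: "F \<subseteq> A" "finite F" for F
  proof -
    have "(\<Sum>x\<in>F. f (g x)) = (\<Sum>y\<in>g ` F. \<Sum>x\<in>{x\<in>F. g x = y}. f (g x))"
      by (rule sum.image_gen[OF F(2)])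
    also have "\<dots> = (\<Sum>y\<in>g ` F. real (card {x\<in>F. g x = y}) * f y)"
      by (intro sum.cong) auto
    also have "\<dots> \<le> (\<Sum>y\<in>g ` F. real N * f y)"
    proof (intro sum_mono mult_right_mono)
      fix y assume y: "y \<in> g ` F"
      then have "y \<in> B" using F g by auto
      then show "0 \<le> f y" using f by auto
      have "card {x\<in>F. g x = y} \<le> card {x\<in>A. g x = y}"
        using F fibre[OF \<open>y \<in> B\<close>] by (intro card_mono) auto
      then show "real (card {x\<in>F. g x = y}) \<le> real N"
        using fibre[OF \<open>y \<in> B\<close>] by linarith
    qed
    also have "\<dots> = real N * sum f (g ` F)" by (simp add: sum_distrib_left)
    also have "\<dots> \<le> real N * infsum f B"
      using F f g by (intro mult_left_mono finite_sum_le_infsum) auto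
    finally show ?thesis .
  qed
  then show "bdd_above (sum (\<lambda>x. f (g x)) ` {F. F \<subseteq> A \<and> finite F})"
    by (intro bdd_aboveI[of _ "real N * infsum f B"]) auto
qed

text \<open>Choosing one preimage for each point of the image turns the sum over the image into a subsum
  of the given one. It is applied to the map from edges of the link graph to simplices.\<close>

lemma summable_on_image:
  fixes f :: "'b \<Rightarrow> real"
  assumes "(\<lambda>x. f (g x)) summable_on A"
  shows "f summable_on (g ` A)"
proof -
  have inj: "inj_on (inv_into A g) (g ` A)" by (rule inj_on_inv_into) simp
  have "(\<lambda>x. f (g x)) summable_on (inv_into A g ` g ` A)"
    using assms by (rule summable_on_subset) (auto intro: inv_into_into)
  then have "((\<lambda>x. f (g x)) \<circ> inv_into A g) summable_on (g ` A)"
    using summable_on_reindex[OF inj] by blast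
  then show ?thesis
    by (rule summable_on_cong[THEN iffD1, rotated]) (simp add: f_inv_into_f)
qed

section \<open>Stochastic kernels and avoidance probabilities\<close>

text \<open>The transition operator of the kernel: the expectation of \<open>f\<close> after one step from \<open>x\<close>.\<close>

definition avg :: "'a set \<Rightarrow> ('a \<Rightarrow> 'a \<Rightarrow> real) \<Rightarrow> ('a \<Rightarrow> real) \<Rightarrow> 'a \<Rightarrow> real" where
  "avg V p f x = (\<Sum>\<^sub>\<infinity>z\<in>V. p x z * f z)"

text \<open>The probability that a chain started at \<open>x\<close> avoids \<open>y\<close> at the times \<open>0, \<dots>, n\<close>. The recursion
  conditions on the first step, which makes the functions independent of any realisation of
  the chain.\<close>

primrec avoid :: "'a set \<Rightarrow> ('a \<Rightarrow> 'a \<Rightarrow> real) \<Rightarrow> 'a \<Rightarrow> nat \<Rightarrow> 'a \<Rightarrow> real" where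
  "avoid V p y 0 x = (if x = y then 0 else 1)"
| "avoid V p y (Suc n) x = (if x = y then 0 else avg V p (avoid V p y n) x)"

locale stochastic_kernel =
  fixes V :: "'a set" and p :: "'a \<Rightarrow> 'a \<Rightarrow> real"
  assumes p_nonneg: "x \<in> V \<Longrightarrow> z \<in> V \<Longrightarrow> 0 \<le> p x z"
    and p_sum: "x \<in> V \<Longrightarrow> (p x has_sum 1) V"
begin

lemma p_summable: "x \<in> V \<Longrightarrow> p x summable_on V"
  using p_sum has_sum_imp_summable by blast

lemma avg_summable:
  assumes "x \<in> V" "\<And>z. z \<in> V \<Longrightarrow> 0 \<le> f z \<and> f z \<le> 1"
  shows "(\<lambda>z. p x z * f z) summable_on V"
  using p_summable[OF assms(1)]
  by (rule summable_on_comparison_test) (use assms p_nonneg in \<open>auto intro: mult_left_le\<close>)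

lemma avg_bounds:
  assumes "x \<in> V" "\<And>z. z \<in> V \<Longrightarrow> 0 \<le> f z \<and> f z \<le> 1"
  shows "0 \<le> avg V p f x" "avg V p f x \<le> 1"
proof -
  show "0 \<le> avg V p f x"
    unfolding avg_def using assms p_nonneg by (intro infsum_nonneg) auto
  have "avg V p f x \<le> infsum (p x) V"
    unfolding avg_def
    by (rule infsum_mono[OF avg_summable p_summable]) (use assms p_nonneg in \<open>auto intro: mult_left_le\<close>)
  then show "avg V p f x \<le> 1" using p_sum[OF assms(1)] infsumI by force
qed

lemma avg_mono:
  assumes "x \<in> V" "\<And>z. z \<in> V \<Longrightarrow> 0 \<le> f z \<and> f z \<le> g z \<and> g z \<le> 1"
  shows "avg V p f x \<le> avg V p g x"
  unfolding avg_def
proof (rule infsum_mono)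
  show "(\<lambda>z. p x z * f z) summable_on V"
    using assms by (intro avg_summable) (auto intro: order_trans)
  show "(\<lambda>z. p x z * g z) summable_on V"
    using assms by (intro avg_summable) (auto intro: order_trans)
  show "p x z * f z \<le> p x z * g z" if "z \<in> V" for z
    using assms that p_nonneg by (intro mult_left_mono) auto
qed

lemma avg_complement:
  assumes "x \<in> V" "\<And>z. z \<in> V \<Longrightarrow> 0 \<le> f z \<and> f z \<le> 1"
  shows "avg V p (\<lambda>z. 1 - f z) x = 1 - avg V p f x"
proof -
  have "((\<lambda>z. p x z - p x z * f z) has_sum (1 - avg V p f x)) V"
    unfolding avg_def
    using has_sum_diff[OF p_sum[OF assms(1)] has_sum_infsum[OF avg_summable[OF assms]]] .
  then show ?thesis unfolding avg_def by (simp add: algebra_simps infsumI)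
qed

lemma avg_tendsto:
  assumes x: "x \<in> V" and f: "\<And>n z. z \<in> V \<Longrightarrow> 0 \<le> f n z \<and> f n z \<le> 1"
    and lim: "\<And>z. z \<in> V \<Longrightarrow> (\<lambda>n. f n z) \<longlonglongrightarrow> g z"
  shows "(\<lambda>n. avg V p (f n) x) \<longlonglongrightarrow> avg V p g x"
  unfolding avg_def
proof (rule infsum_tendsto_dominated[OF _ _ p_summable[OF x]])
  show "(\<lambda>n. p x z * f n z) \<longlonglongrightarrow> p x z * g z" if "z \<in> V" for z
    by (rule tendsto_mult_left[OF lim[OF that]])
  show "norm (p x z * f n z) \<le> p x z" if "z \<in> V" for n z
  proof -
    have "0 \<le> f n z" "f n z \<le> 1" "0 \<le> p x z"
      using f[OF that, of n] p_nonneg[OF x that] by blast+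
    then show ?thesis by (simp add: abs_mult mult_left_le)
  qed
qed

lemma avoid_bounds: "x \<in> V \<Longrightarrow> 0 \<le> avoid V p y n x \<and> avoid V p y n x \<le> 1"
proof (induction n arbitrary: x)
  case (Suc n)
  have "0 \<le> avg V p (avoid V p y n) x \<and> avg V p (avoid V p y n) x \<le> 1"
    using avg_bounds[OF Suc.prems] Suc.IH by blast
  then show ?case by simp
qed simp

lemma avoid_self [simp]: "avoid V p y n y = 0"
  by (cases n) auto

lemma avoid_decreasing: "x \<in> V \<Longrightarrow> avoid V p y (Suc n) x \<le> avoid V p y n x"
proof (induction n arbitrary: x)
  case 0
  then show ?case using avoid_bounds[of x y "Suc 0"] by (simp split: if_splits)
next
  case (Suc n)
  have "avg V p (avoid V p y (Suc n)) x \<le> avg V p (avoid V p y n) x"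
    using avg_mono[OF Suc.prems] Suc.IH avoid_bounds by metis
  then show ?case unfolding avoid.simps(2)[of V p y n] avoid.simps(2)[of V p y "Suc n"] by simp
qed

lemma avoid_tendsto:
  assumes "x \<in> V"
  shows "(\<lambda>n. avoid V p y n x) \<longlonglongrightarrow> lim (\<lambda>n. avoid V p y n x)"
proof -
  have "decseq (\<lambda>n. avoid V p y n x)"
    using avoid_decreasing[OF assms] by (intro decseq_SucI)
  then obtain L where "(\<lambda>n. avoid V p y n x) \<longlonglongrightarrow> L"
    by (rule decseq_convergent[of _ 0]) (simp_all add: avoid_bounds[OF assms])
  then show ?thesis by (simp add: limI)
qed

end

section \<open>Return probabilities of Markov chains\<close>

text \<open>The link between unordered sums and integrals over counting measure: countable additivity of
  measures yields integrals, whereas kernels and weights are described by sums.\<close>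

lemma has_sum_iff_nn_integral_count_space:
  fixes f :: "'b \<Rightarrow> real"
  assumes "\<And>x. x \<in> A \<Longrightarrow> 0 \<le> f x" "0 \<le> s"
  shows "(f has_sum s) A \<longleftrightarrow> (\<integral>\<^sup>+x. ennreal (f x) \<partial>count_space A) = ennreal s"
proof -
  have nn: "(\<integral>\<^sup>+x. ennreal (f x) \<partial>count_space A) = ennreal (infsum f A)"
    if "integrable (count_space A) f"
  proof -
    have "infsetsum f A = infsum f A"
      by (rule infsetsum_infsum) (use that in \<open>simp add: abs_summable_on_def\<close>)
    then show ?thesis
      using nn_integral_eq_integral[OF that] assms by (simp add: AE_count_space infsetsum_def)
  qed
  show ?thesis
  proof
    assume *: "(f has_sum s) A"
    then have "integrable (count_space A) f"
      using abs_summable_equivalent[of f A] summable_on_iff_abs_summable_on_real[of f A]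
        has_sum_imp_summable[OF *]
      unfolding abs_summable_on_def by blast
    then show "(\<integral>\<^sup>+x. ennreal (f x) \<partial>count_space A) = ennreal s"
      using nn infsumI[OF *] by simp
  next
    assume *: "(\<integral>\<^sup>+x. ennreal (f x) \<partial>count_space A) = ennreal s"
    have int: "integrable (count_space A) f"
      by (rule integrableI_nn_integral_finite[OF _ _ *]) (use assms in \<open>auto simp: AE_count_space\<close>)
    then have "f summable_on A"
      using abs_summable_equivalent[of f A] summable_on_iff_abs_summable_on_real[of f A]
      unfolding abs_summable_on_def by blast
    moreover have "0 \<le> infsum f A" using assms by (intro infsum_nonneg)
    ultimately show "(f has_sum s) A"
      using nn[OF int] * assms(2) by (simp add: has_sum_iff)
  qed
qed

lemma (in prob_space) prob_has_sum_countable_partition: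
  assumes "countable V" "Y \<in> measurable M (count_space V)" "{\<omega>\<in>space M. Q \<omega>} \<in> sets M"
  shows "((\<lambda>z. prob {\<omega>\<in>space M. Y \<omega> = z \<and> Q \<omega>}) has_sum prob {\<omega>\<in>space M. Q \<omega>}) V"
proof -
  have sets: "{\<omega>\<in>space M. Y \<omega> = z \<and> Q \<omega>} \<in> sets M" if "z \<in> V" for z
  proof -
    have "Y -` {z} \<inter> space M \<in> sets M" using assms(2) that by (intro measurable_sets) auto
    then have "(Y -` {z} \<inter> space M) \<inter> {\<omega>\<in>space M. Q \<omega>} \<in> sets M" using assms(3) by blast
    moreover have "(Y -` {z} \<inter> space M) \<inter> {\<omega>\<in>space M. Q \<omega>} = {\<omega>\<in>space M. Y \<omega> = z \<and> Q \<omega>}" by auto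
    ultimately show ?thesis by simp
  qed
  have "{\<omega>\<in>space M. Q \<omega>} = (\<Union>z\<in>V. {\<omega>\<in>space M. Y \<omega> = z \<and> Q \<omega>})"
    using measurable_space[OF assms(2)] by auto
  then have "emeasure M {\<omega>\<in>space M. Q \<omega>}
      = (\<integral>\<^sup>+z. emeasure M {\<omega>\<in>space M. Y \<omega> = z \<and> Q \<omega>} \<partial>count_space V)"
    using emeasure_UN_countable[of V "\<lambda>z. {\<omega>\<in>space M. Y \<omega> = z \<and> Q \<omega>}" M] sets assms(1)
    by (auto simp: disjoint_family_on_def)
  then show ?thesis
    by (subst has_sum_iff_nn_integral_count_space) (auto simp: emeasure_eq_measure)
qed

context stochastic_kernel
begin

lemma chain_measurable_sets:
  assumes "markov_chain V p M Y" "z \<in> V"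
  shows "{\<omega>\<in>space M. Y k \<omega> = z} \<in> sets M"
proof -
  have "Y k \<in> measurable M (count_space V)" using assms(1) by (simp add: markov_chain_def)
  then have "Y k -` {z} \<inter> space M \<in> sets M" using assms(2) by (intro measurable_sets) auto
  moreover have "Y k -` {z} \<inter> space M = {\<omega>\<in>space M. Y k \<omega> = z}" by auto
  ultimately show ?thesis by simp
qed

lemma chain_path_sets:
  assumes "markov_chain V p M Y" "\<And>k. k \<le> j \<Longrightarrow> x k \<in> V"
  shows "{\<omega>\<in>space M. \<forall>k\<le>j. Y k \<omega> = x k} \<in> sets M"
proof -
  have "{\<omega>\<in>space M. \<forall>k\<in>{..j}. Y k \<omega> = x k} \<in> sets M"
  proof (rule sets.sets_Collect_finite_All)
    show "{\<omega>\<in>space M. Y k \<omega> = x k} \<in> sets M" if "k \<in> {..j}" for k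
      by (rule chain_measurable_sets[OF assms(1)]) (use that assms(2) in blast)
  qed simp
  then show ?thesis by (simp only: Ball_def atMost_iff)
qed

text \<open>The defining property of a Markov chain only speaks about paths of positive probability. In
  product form it holds for all paths, since both sides vanish on null paths.\<close>

lemma chain_path_extend:
  assumes mc: "markov_chain V p M Y" and x: "\<And>k. k \<le> j \<Longrightarrow> x k \<in> V" and z: "z \<in> V"
  shows "\<P>(\<omega> in M. (\<forall>k\<le>j. Y k \<omega> = x k) \<and> Y (Suc j) \<omega> = z)
       = \<P>(\<omega> in M. \<forall>k\<le>j. Y k \<omega> = x k) * p (x j) z"
proof -
  interpret prob_space M using mc unfolding markov_chain_def by blast
  let ?A = "{\<omega>\<in>space M. \<forall>k\<le>j. Y k \<omega> = x k}"
  let ?B = "{\<omega>\<in>space M. (\<forall>k\<le>j. Y k \<omega> = x k) \<and> Y (Suc j) \<omega> = z}"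
  have A: "?A \<in> sets M" by (rule chain_path_sets[OF mc x])
  show ?thesis
  proof (cases "prob ?A > 0")
    case True
    define x' where "x' = x(Suc j := z)"
    have eq: "(\<forall>k\<le>j. Y k \<omega> = x' k) \<longleftrightarrow> (\<forall>k\<le>j. Y k \<omega> = x k)" for \<omega>
      by (auto simp: x'_def)
    have "\<forall>k\<le>Suc j. x' k \<in> V" using x z by (auto simp: x'_def le_Suc_eq)
    then have "\<P>(\<omega> in M. Y (Suc j) \<omega> = x' (Suc j) \<bar> \<forall>k\<le>j. Y k \<omega> = x' k) = p (x' j) (x' (Suc j))"
      using mc True unfolding markov_chain_def eq[symmetric] by blast
    then show ?thesis
      using True unfolding eq by (simp add: x'_def cond_prob_def field_simps conj_commute)
  next
    case False
    then have 0: "prob ?A = 0" by (simp only: not_less measure_le_0_iff)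
    have "prob ?B \<le> prob ?A" by (rule finite_measure_mono[OF _ A]) blast
    then have "prob ?B = 0" by (simp only: 0 measure_le_0_iff)
    then show ?thesis by (simp only: 0 mult_zero_left)
  qed
qed

text \<open>The event is split according to the countably many values of the state at time \<open>Suc j\<close>; on each
  piece the conditional probability is known by assumption.\<close>

lemma chain_condition_on_next_state:
  assumes mc: "markov_chain V p M Y" and V: "countable V" and x: "\<And>k. k \<le> j \<Longrightarrow> x k \<in> V"
    and Q: "{\<omega>\<in>space M. Q \<omega>} \<in> sets M"
    and next_state: "\<And>z. z \<in> V \<Longrightarrow>
      \<P>(\<omega> in M. (\<forall>k\<le>j. Y k \<omega> = x k) \<and> Y (Suc j) \<omega> = z \<and> Q \<omega>)
        = \<P>(\<omega> in M. (\<forall>k\<le>j. Y k \<omega> = x k) \<and> Y (Suc j) \<omega> = z) * g z"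
  shows "\<P>(\<omega> in M. (\<forall>k\<le>j. Y k \<omega> = x k) \<and> Q \<omega>)
       = \<P>(\<omega> in M. \<forall>k\<le>j. Y k \<omega> = x k) * avg V p g (x j)"
proof -
  interpret prob_space M using mc unfolding markov_chain_def by blast
  let ?A = "\<lambda>\<omega>. \<forall>k\<le>j. Y k \<omega> = x k"
  have "{\<omega>\<in>space M. ?A \<omega>} \<inter> {\<omega>\<in>space M. Q \<omega>} \<in> sets M"
    by (rule sets.Int[OF chain_path_sets[OF mc x] Q])
  moreover have "{\<omega>\<in>space M. ?A \<omega>} \<inter> {\<omega>\<in>space M. Q \<omega>} = {\<omega>\<in>space M. ?A \<omega> \<and> Q \<omega>}" by auto
  ultimately have sets: "{\<omega>\<in>space M. ?A \<omega> \<and> Q \<omega>} \<in> sets M" by (simp only:)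
  have "Y (Suc j) \<in> measurable M (count_space V)" using mc unfolding markov_chain_def by blast
  from prob_has_sum_countable_partition[OF V this sets]
  have "((\<lambda>z. \<P>(\<omega> in M. Y (Suc j) \<omega> = z \<and> ?A \<omega> \<and> Q \<omega>)) has_sum
      \<P>(\<omega> in M. ?A \<omega> \<and> Q \<omega>)) V" .
  moreover have "\<P>(\<omega> in M. Y (Suc j) \<omega> = z \<and> ?A \<omega> \<and> Q \<omega>) = \<P>(\<omega> in M. ?A \<omega>) * (p (x j) z * g z)"
    if z: "z \<in> V" for z
  proof -
    have "\<P>(\<omega> in M. Y (Suc j) \<omega> = z \<and> ?A \<omega> \<and> Q \<omega>) = \<P>(\<omega> in M. ?A \<omega> \<and> Y (Suc j) \<omega> = z \<and> Q \<omega>)"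
      by (rule arg_cong[where f = prob]) auto
    then show ?thesis
      using next_state[OF z] chain_path_extend[where x = x, OF mc x z] by simp
  qed
  ultimately have "((\<lambda>z. \<P>(\<omega> in M. ?A \<omega>) * (p (x j) z * g z)) has_sum \<P>(\<omega> in M. ?A \<omega> \<and> Q \<omega>)) V"
    by (subst has_sum_cong[symmetric]) auto
  then show ?thesis unfolding avg_def infsum_cmult_right'[symmetric] by (simp add: infsumI)
qed

lemma chain_avoid_sets:
  assumes mc: "markov_chain V p M Y" and y: "y \<in> V"
  shows "{\<omega>\<in>space M. \<forall>i\<le>n. Y (j + i) \<omega> \<noteq> y} \<in> sets M"
proof -
  have "{\<omega>\<in>space M. \<not> Y k \<omega> = y} \<in> sets M" for k
    using chain_measurable_sets[OF mc y] by (rule sets.sets_Collect_neg)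
  then have "{\<omega>\<in>space M. \<forall>i\<in>{..n}. \<not> Y (j + i) \<omega> = y} \<in> sets M"
    by (intro sets.sets_Collect_finite_All finite_atMost)
  then show ?thesis by (simp only: Ball_def atMost_iff)
qed

text \<open>The recursion for \<open>avoid\<close> steps forward from the start, while a Markov chain is specified by
  extending paths at their end. Conditioning on a path of arbitrary length \<open>j\<close> reconciles both: in
  the induction on \<open>n\<close> the path grows by one state.\<close>

lemma chain_avoid_prob:
  assumes mc: "markov_chain V p M Y" and V: "countable V" and y: "y \<in> V"
    and x: "\<And>k. k \<le> j \<Longrightarrow> x k \<in> V"
  shows "\<P>(\<omega> in M. (\<forall>k\<le>j. Y k \<omega> = x k) \<and> (\<forall>i\<le>n. Y (Suc j + i) \<omega> \<noteq> y))
       = \<P>(\<omega> in M. \<forall>k\<le>j. Y k \<omega> = x k) * avg V p (avoid V p y n) (x j)"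
proof -
  interpret prob_space M using mc unfolding markov_chain_def by blast
  have step: "\<P>(\<omega> in M. (\<forall>k\<le>j. Y k \<omega> = x k) \<and> (\<forall>i\<le>n. Y (Suc j + i) \<omega> \<noteq> y))
       = \<P>(\<omega> in M. \<forall>k\<le>j. Y k \<omega> = x k) * avg V p (avoid V p y n) (x j)"
    if IH: "\<And>j x. (\<And>k. k \<le> j \<Longrightarrow> x k \<in> V) \<Longrightarrow>
      \<P>(\<omega> in M. (\<forall>k\<le>j. Y k \<omega> = x k) \<and> (\<forall>i\<le>n. Y (j + i) \<omega> \<noteq> y))
       = \<P>(\<omega> in M. \<forall>k\<le>j. Y k \<omega> = x k) * avoid V p y n (x j)"
      and x: "\<And>k. k \<le> j \<Longrightarrow> x k \<in> V" for n j x
  proof (rule chain_condition_on_next_state[OF mc V x chain_avoid_sets[OF mc y]])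
    fix z assume z: "z \<in> V"
    have ext: "(\<forall>k\<le>Suc j. Y k \<omega> = (x(Suc j := z)) k) \<longleftrightarrow> (\<forall>k\<le>j. Y k \<omega> = x k) \<and> Y (Suc j) \<omega> = z"
      for \<omega> by (auto simp: le_Suc_eq)
    have "(x(Suc j := z)) k \<in> V" if "k \<le> Suc j" for k
      using that x z by (cases "k = Suc j") auto
    from IH[of "Suc j" "x(Suc j := z)", OF this]
    show "\<P>(\<omega> in M. (\<forall>k\<le>j. Y k \<omega> = x k) \<and> Y (Suc j) \<omega> = z \<and> (\<forall>i\<le>n. Y (Suc j + i) \<omega> \<noteq> y))
        = \<P>(\<omega> in M. (\<forall>k\<le>j. Y k \<omega> = x k) \<and> Y (Suc j) \<omega> = z) * avoid V p y n z"
      unfolding ext by (simp add: conj_assoc)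
  qed
  have main: "\<P>(\<omega> in M. (\<forall>k\<le>j. Y k \<omega> = x k) \<and> (\<forall>i\<le>n. Y (j + i) \<omega> \<noteq> y))
       = \<P>(\<omega> in M. \<forall>k\<le>j. Y k \<omega> = x k) * avoid V p y n (x j)"
    if x: "\<And>k. k \<le> j \<Longrightarrow> x k \<in> V" for n j x
    using x
  proof (induction n arbitrary: j x)
    case 0
    show ?case
    proof (cases "x j = y")
      case True
      then have "{\<omega>\<in>space M. (\<forall>k\<le>j. Y k \<omega> = x k) \<and> (\<forall>i\<le>0. Y (j + i) \<omega> \<noteq> y)} = {}" by auto
      then show ?thesis using True by (simp only:) simp
    next
      case False
      then have "{\<omega>\<in>space M. (\<forall>k\<le>j. Y k \<omega> = x k) \<and> (\<forall>i\<le>0. Y (j + i) \<omega> \<noteq> y)}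
          = {\<omega>\<in>space M. \<forall>k\<le>j. Y k \<omega> = x k}" by auto
      then show ?thesis using False by (simp only:) simp
    qed
  next
    case (Suc n)
    show ?case
    proof (cases "x j = y")
      case True
      then have "{\<omega>\<in>space M. (\<forall>k\<le>j. Y k \<omega> = x k) \<and> (\<forall>i\<le>Suc n. Y (j + i) \<omega> \<noteq> y)} = {}" by force
      then show ?thesis using True by (simp only:) simp
    next
      case False
      have "(\<forall>i\<le>Suc n. Y (j + i) \<omega> \<noteq> y) \<longleftrightarrow> Y j \<omega> \<noteq> y \<and> (\<forall>i\<le>n. Y (Suc j + i) \<omega> \<noteq> y)" for \<omega>
        by (simp only: atMost_iff[symmetric] atMost_Suc_eq_insert_0 ball_simps Ball_def[symmetric]) simp
      then have "{\<omega>\<in>space M. (\<forall>k\<le>j. Y k \<omega> = x k) \<and> (\<forall>i\<le>Suc n. Y (j + i) \<omega> \<noteq> y)}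
          = {\<omega>\<in>space M. (\<forall>k\<le>j. Y k \<omega> = x k) \<and> (\<forall>i\<le>n. Y (Suc j + i) \<omega> \<noteq> y)}"
        using False by auto
      then show ?thesis using step[OF Suc.IH Suc.prems] False by (simp only:) simp
    qed
  qed
  show "\<P>(\<omega> in M. (\<forall>k\<le>j. Y k \<omega> = x k) \<and> (\<forall>i\<le>n. Y (Suc j + i) \<omega> \<noteq> y))
       = \<P>(\<omega> in M. \<forall>k\<le>j. Y k \<omega> = x k) * avg V p (avoid V p y n) (x j)"
    by (rule step[OF main x])
qed

text \<open>Continuity from above along the decreasing events that \<open>y\<close> is avoided at the times
  \<open>1, \<dots>, n + 1\<close>.\<close>

lemma return_prob_eq_1_iff:
  assumes mc: "markov_chain V p M Y" and V: "countable V" and x: "x \<in> V" and y: "y \<in> V"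
    and start: "\<P>(\<omega> in M. Y 0 \<omega> = x) > 0"
  shows "\<P>(\<omega> in M. (\<exists>k>0. Y k \<omega> = y) \<bar> Y 0 \<omega> = x) = 1
    \<longleftrightarrow> (\<lambda>n. avg V p (avoid V p y n) x) \<longlonglongrightarrow> 0"
proof -
  interpret prob_space M using mc unfolding markov_chain_def by blast
  let ?S = "{\<omega>\<in>space M. Y 0 \<omega> = x}"
  define N where "N n = {\<omega>\<in>space M. Y 0 \<omega> = x \<and> (\<forall>i\<le>n. Y (Suc i) \<omega> \<noteq> y)}" for n
  have S: "?S \<in> sets M" by (rule chain_measurable_sets[OF mc x])
  have N: "N n \<in> sets M" for n
  proof -
    have "?S \<inter> {\<omega>\<in>space M. \<forall>i\<le>n. Y (1 + i) \<omega> \<noteq> y} \<in> sets M"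
      using S chain_avoid_sets[OF mc y] by blast
    moreover have "?S \<inter> {\<omega>\<in>space M. \<forall>i\<le>n. Y (1 + i) \<omega> \<noteq> y} = N n" by (auto simp: N_def)
    ultimately show ?thesis by simp
  qed
  have prob_N: "prob (N n) = prob ?S * avg V p (avoid V p y n) x" for n
    using chain_avoid_prob[OF mc V y, of 0 "\<lambda>_. x" n] x by (simp add: N_def)
  have "(\<lambda>n. prob (N n)) \<longlonglongrightarrow> prob (\<Inter>n. N n)"
  proof (rule finite_Lim_measure_decseq)
    show "decseq N" unfolding decseq_def N_def using le_trans by blast
  qed (use N in blast)
  then have lim: "(\<lambda>n. prob ?S * avg V p (avoid V p y n) x) \<longlonglongrightarrow> prob (\<Inter>n. N n)"
    unfolding prob_N .
  have "{\<omega>\<in>space M. (\<exists>k>0. Y k \<omega> = y) \<and> Y 0 \<omega> = x} = ?S - (\<Inter>n. N n)"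
    by (auto simp: N_def gr0_conv_Suc)
  moreover have "prob (?S - (\<Inter>n. N n)) = prob ?S - prob (\<Inter>n. N n)"
  proof (rule finite_measure_Diff[OF S])
    show "(\<Inter>n. N n) \<in> sets M" using N by (intro sets.countable_INT) auto
    show "(\<Inter>n. N n) \<subseteq> ?S" unfolding N_def by blast
  qed
  ultimately have "\<P>(\<omega> in M. (\<exists>k>0. Y k \<omega> = y) \<bar> Y 0 \<omega> = x) = 1
      \<longleftrightarrow> prob ?S - prob (\<Inter>n. N n) = prob ?S"
    using start unfolding cond_prob_def by simp
  also have "\<dots> \<longleftrightarrow> prob (\<Inter>n. N n) = 0" by linarith
  also have "\<dots> \<longleftrightarrow> (\<lambda>n. prob ?S * avg V p (avoid V p y n) x) \<longlonglongrightarrow> 0"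
  proof
    assume "prob (\<Inter>n. N n) = 0"
    with lim show "(\<lambda>n. prob ?S * avg V p (avoid V p y n) x) \<longlonglongrightarrow> 0" by (simp only:)
  qed (rule LIMSEQ_unique[OF lim])
  also have "\<dots> \<longleftrightarrow> (\<lambda>n. avg V p (avoid V p y n) x) \<longlonglongrightarrow> 0"
    using tendsto_mult_left_iff[of "prob ?S" "\<lambda>n. avg V p (avoid V p y n) x" 0 sequentially] start by simp
  finally show ?thesis .
qed

end

section \<open>Existence of Markov chains\<close>

context stochastic_kernel
begin

lemma prob_space_step:
  assumes "x \<in> V"
  shows "prob_space (point_measure V (\<lambda>z. ennreal (p x z)))"
proof
  have "(\<integral>\<^sup>+z. ennreal (p x z) \<partial>count_space V) = 1"
    using has_sum_iff_nn_integral_count_space[of V "p x" 1] p_nonneg[OF assms] p_sum[OF assms] by simp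
  then show "emeasure (point_measure V (\<lambda>z. ennreal (p x z))) (space (point_measure V (\<lambda>z. ennreal (p x z)))) = 1"
    by (simp add: point_measure_def emeasure_density space_density nn_integral_restrict_space[symmetric]
        restrict_count_space)
qed

lemma measure_step_singleton:
  assumes "x \<in> V" "z \<in> V"
  shows "measure (point_measure V (\<lambda>z. ennreal (p x z))) {z} = p x z"
proof -
  have "emeasure (point_measure V (\<lambda>z. ennreal (p x z))) {z} = ennreal (p x z)"
    using assms by (subst emeasure_point_measure_finite2) auto
  then show ?thesis using p_nonneg[OF assms] by (simp add: measure_def)
qed

text \<open>Attach to every time \<open>k\<close> and every state \<open>x\<close> an independent random variable with distribution
  \<open>p x\<close>, and let the chain move at time \<open>k\<close> from its state \<open>x\<close> to the value of the variable
  belonging to \<open>(k, x)\<close>. A prescribed path fixes the values of finitely many distinct variables,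
  so its probability is the product of the transition probabilities. Coding the pairs
  \<open>(k, x)\<close> as natural numbers makes the sample points sequences of states.\<close>

lemma markov_chain_exists:
  assumes V: "countable V" and x0: "x0 \<in> V"
  obtains M :: "(nat \<Rightarrow> 'a) measure" and Y
  where "markov_chain V p M Y" "\<P>(\<omega> in M. Y 0 \<omega> = x0) > 0"
proof -
  \<comment> \<open>Since \<open>from_nat_into\<close> maps into \<open>V\<close>, every natural number codes a time and a state, so every
    coordinate has a distribution, also those that the chain never uses.\<close>
  define code where "code k x = prod_encode (k, to_nat_on V x)" for k x
  define K where "K i = point_measure V (\<lambda>z. ennreal (p (from_nat_into V (snd (prod_decode i))) z))" for i
  have V_ne: "V \<noteq> {}" using x0 by auto
  have prob_K: "prob_space (K i)" for i
    unfolding K_def by (rule prob_space_step[OF from_nat_into[OF V_ne]])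
  interpret product_prob_space K UNIV using prob_K by (intro product_prob_spaceI)
  let ?M = "PiM UNIV K"
  have space_K: "space (K i) = V" and sets_K: "sets (K i) = Pow V" for i
    by (simp_all add: K_def space_point_measure sets_point_measure)
  have K_code: "K (code k x) = point_measure V (\<lambda>z. ennreal (p x z))" if "x \<in> V" for k x
    using that V by (simp add: K_def code_def)
  have code_inj: "code k x = code k' x' \<longleftrightarrow> k = k' \<and> x = x'" if "x \<in> V" "x' \<in> V" for k k' x x'
    using that V by (simp add: code_def)
  define Y where "Y = rec_nat (\<lambda>_. x0) (\<lambda>k X \<omega>. \<omega> (code k (X \<omega>)))"
  have Y_0: "Y 0 \<omega> = x0" and Y_Suc: "Y (Suc k) \<omega> = \<omega> (code k (Y k \<omega>))" for k \<omega>
    by (simp_all add: Y_def)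
  have comp: "(\<lambda>\<omega>. \<omega> i) \<in> measurable ?M (count_space V)" for i
  proof -
    have "(\<lambda>\<omega>. \<omega> i) \<in> measurable ?M (K i)" by (rule measurable_component_singleton) simp
    moreover have "measurable ?M (K i) = measurable ?M (count_space V)"
      by (rule measurable_cong_sets) (simp_all add: sets_K)
    ultimately show ?thesis by simp
  qed
  have Y_meas: "Y k \<in> measurable ?M (count_space V)" for k
  proof (induction k)
    case 0
    then show ?case using x0 by (simp add: Y_0[abs_def])
  next
    case (Suc k)
    have "(\<lambda>\<omega>. \<omega> (code k (Y k \<omega>))) \<in> measurable ?M (count_space V)"
      by (rule measurable_compose_countable'[where f = "\<lambda>z \<omega>. \<omega> (code k z)" and g = "Y k", OF comp Suc V])
    then show ?case by (simp add: Y_Suc[abs_def])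
  qed
  have path: "measure ?M {\<omega>\<in>space ?M. \<forall>k\<le>n. Y k \<omega> = x k} = (\<Prod>k<n. p (x k) (x (Suc k)))"
    if x: "\<And>k. k \<le> n \<Longrightarrow> x k \<in> V" and "x 0 = x0" for n x
  proof -
    let ?J = "(\<lambda>k. code k (x k)) ` {..<n}"
    let ?X = "\<lambda>i. {x (Suc (fst (prod_decode i)))}"
    have inj: "inj_on (\<lambda>k. code k (x k)) {..<n}"
      using code_inj x by (auto intro!: inj_onI)
    have path_iff: "(\<forall>k\<le>n. Y k \<omega> = x k) \<longleftrightarrow> (\<forall>k<n. \<omega> (code k (x k)) = x (Suc k))" for \<omega>
    proof
      assume *: "\<forall>k\<le>n. Y k \<omega> = x k"
      show "\<forall>k<n. \<omega> (code k (x k)) = x (Suc k)"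
      proof (intro allI impI)
        fix k assume "k < n"
        then have "Y k \<omega> = x k" "Y (Suc k) \<omega> = x (Suc k)" using * by auto
        then show "\<omega> (code k (x k)) = x (Suc k)" by (simp add: Y_Suc)
      qed
    next
      assume *: "\<forall>k<n. \<omega> (code k (x k)) = x (Suc k)"
      have "k \<le> n \<Longrightarrow> Y k \<omega> = x k" for k
        by (induction k) (use * \<open>x 0 = x0\<close> in \<open>auto simp: Y_0 Y_Suc\<close>)
      then show "\<forall>k\<le>n. Y k \<omega> = x k" by blast
    qed
    have "(\<forall>k<n. \<omega> (code k (x k)) = x (Suc k)) \<longleftrightarrow> (\<forall>i\<in>?J. \<omega> i \<in> ?X i)" for \<omega>
      by (auto simp: code_def)
    then have "measure ?M {\<omega>\<in>space ?M. \<forall>k\<le>n. Y k \<omega> = x k} = measure ?M {\<omega>\<in>space ?M. \<forall>i\<in>?J. \<omega> i \<in> ?X i}"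
      unfolding path_iff by simp
    also have "\<dots> = (\<Prod>i\<in>?J. measure (K i) (?X i))"
    proof -
      have X: "?X i \<in> sets (K i)" if "i \<in> ?J" for i
        using that x by (auto simp: sets_K code_def)
      have "{\<omega>\<in>space ?M. \<forall>i\<in>?J. \<omega> i \<in> ?X i} = prod_emb UNIV K ?J (Pi\<^sub>E ?J ?X)"
        unfolding prod_emb_def by (auto simp: space_PiM Pi_iff)
      then show ?thesis using measure_PiM_emb[of ?J ?X, OF _ _ X] by simp
    qed
    also have "\<dots> = (\<Prod>k<n. measure (K (code k (x k))) {x (Suc k)})"
      by (subst prod.reindex[OF inj]) (simp add: code_def)
    also have "\<dots> = (\<Prod>k<n. p (x k) (x (Suc k)))"
      by (rule prod.cong) (use x in \<open>simp_all add: K_code measure_step_singleton\<close>)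
    finally show ?thesis .
  qed
  have "markov_chain V p ?M Y"
    unfolding markov_chain_def
  proof (intro conjI allI impI)
    show "prob_space ?M" by (rule P.prob_space_axioms)
    show "Y n \<in> measurable ?M (count_space V)" for n by (rule Y_meas)
    fix n x
    assume x: "\<forall>k\<le>Suc n. x k \<in> V" and pos: "0 < \<P>(\<omega> in ?M. \<forall>k\<le>n. Y k \<omega> = x k)"
    \<comment> \<open>The chain starts at \<open>x0\<close>, so paths from elsewhere are null.\<close>
    have "x 0 = x0"
    proof (rule ccontr)
      assume "x 0 \<noteq> x0"
      then have "{\<omega>\<in>space ?M. \<forall>k\<le>n. Y k \<omega> = x k} = {}" using Y_0 by force
      then show False using pos by (simp only:) simp
    qed
    have "{\<omega>\<in>space ?M. Y (Suc n) \<omega> = x (Suc n) \<and> (\<forall>k\<le>n. Y k \<omega> = x k)}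
        = {\<omega>\<in>space ?M. \<forall>k\<le>Suc n. Y k \<omega> = x k}" by (auto simp: le_Suc_eq)
    moreover have "\<P>(\<omega> in ?M. \<forall>k\<le>Suc n. Y k \<omega> = x k)
        = \<P>(\<omega> in ?M. \<forall>k\<le>n. Y k \<omega> = x k) * p (x n) (x (Suc n))"
      using path[of "Suc n" x] path[of n x] x \<open>x 0 = x0\<close> by simp
    ultimately show "\<P>(\<omega> in ?M. Y (Suc n) \<omega> = x (Suc n) \<bar> \<forall>k\<le>n. Y k \<omega> = x k) = p (x n) (x (Suc n))"
      using pos unfolding cond_prob_def by simp
  qed
  moreover have "\<P>(\<omega> in ?M. Y 0 \<omega> = x0) > 0"
    using P.prob_space by (simp add: Y_0)
  ultimately show ?thesis using that by blast
qed

end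

section \<open>Energy of hitting probabilities\<close>

text \<open>A connected graph in which every vertex has a neighbour, so that all degrees are positive and the
  random walk is defined.\<close>

locale weighted_graph =
  fixes V :: "'a set" and b :: "'a \<Rightarrow> 'a \<Rightarrow> real"
  assumes b_nonneg: "x \<in> V \<Longrightarrow> z \<in> V \<Longrightarrow> 0 \<le> b x z"
    and b_sym: "x \<in> V \<Longrightarrow> z \<in> V \<Longrightarrow> b x z = b z x"
    and b_summable: "x \<in> V \<Longrightarrow> b x summable_on V"
    and has_neighbour: "x \<in> V \<Longrightarrow> \<exists>z\<in>V. 0 < b x z"
    and connected: "x \<in> V \<Longrightarrow> z \<in> V \<Longrightarrow> (\<lambda>u v. u \<in> V \<and> v \<in> V \<and> 0 < b u v)\<^sup>*\<^sup>* x z"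
begin

definition deg :: "'a \<Rightarrow> real" where "deg x = infsum (b x) V"

abbreviation p where "p \<equiv> transition_probability V b"

lemma deg_has_sum: "x \<in> V \<Longrightarrow> (b x has_sum deg x) V"
  unfolding deg_def by (rule has_sum_infsum[OF b_summable])

lemma deg_pos:
  assumes "x \<in> V" shows "0 < deg x"
proof -
  obtain z where z: "z \<in> V" "0 < b x z" using has_neighbour[OF assms] by blast
  have "sum (b x) {z} \<le> infsum (b x) V"
    using z assms b_nonneg by (intro finite_sum_le_infsum b_summable) auto
  then show ?thesis using z by (simp add: deg_def)
qed

lemma p_eq: "p x z = b x z / deg x"
  by (simp add: transition_probability_def deg_def)

sublocale stochastic_kernel V p
proof
  show "0 \<le> p x z" if "x \<in> V" "z \<in> V" for x z
    using that b_nonneg deg_pos by (simp add: p_eq less_imp_le)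
  show "(p x has_sum 1) V" if "x \<in> V" for x
    using has_sum_divide_const[OF deg_has_sum[OF that], of "deg x"] deg_pos[OF that]
    by (simp add: p_eq[abs_def])
qed

lemma deg_avg: "x \<in> V \<Longrightarrow> deg x * avg V p f x = (\<Sum>\<^sub>\<infinity>z\<in>V. b x z * f z)"
  unfolding avg_def infsum_cmult_right'[symmetric]
  by (rule infsum_cong) (use deg_pos in \<open>force simp: p_eq\<close>)

lemma pair_summable_fst:
  assumes "\<And>x. x \<in> V \<Longrightarrow> 0 \<le> g x" "(\<lambda>x. deg x * g x) summable_on V"
  shows "(\<lambda>(x, z). b x z * g x) summable_on V \<times> V"
proof (rule summable_on_SigmaI[where g = "\<lambda>x. deg x * g x"])
  show "((\<lambda>z. case (x, z) of (x, z) \<Rightarrow> b x z * g x) has_sum deg x * g x) V" if "x \<in> V" for x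
    using has_sum_cmult_left[OF deg_has_sum[OF that]] by simp
qed (use assms b_nonneg in auto)

lemma summable_pairs_swap:
  "(\<lambda>(x, z). f x z) summable_on V \<times> V \<longleftrightarrow> (\<lambda>(x, z). f z x) summable_on V \<times> V"
  using summable_on_swap[of "\<lambda>(x, z). f x z" V V] by simp

lemma infsum_pairs_swap:
  "(\<Sum>\<^sub>\<infinity>(x, z)\<in>V \<times> V. f x z) = (\<Sum>\<^sub>\<infinity>(x, z)\<in>V \<times> V. f z x)"
  using infsum_reindex[of prod.swap "V \<times> V" "\<lambda>(x, z). f x z"]
  by (simp add: o_def case_prod_unfold product_swap)

lemma pair_summable_snd:
  assumes "\<And>x. x \<in> V \<Longrightarrow> 0 \<le> g x" "(\<lambda>x. deg x * g x) summable_on V"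
  shows "(\<lambda>(x, z). b x z * g z) summable_on V \<times> V"
proof -
  have "(\<lambda>(x, z). b z x * g z) summable_on V \<times> V"
    using pair_summable_fst[OF assms] summable_pairs_swap by blast
  then show ?thesis
    by (rule summable_on_cong[THEN iffD1, rotated]) (use b_sym in auto)
qed

definition hit :: "'a \<Rightarrow> nat \<Rightarrow> 'a \<Rightarrow> real" where
  "hit y n x = 1 - avoid V p y n x"

lemma hit_bounds: "x \<in> V \<Longrightarrow> 0 \<le> hit y n x \<and> hit y n x \<le> 1"
  unfolding hit_def using avoid_bounds[of x y n] by auto

lemma deg_hit_Suc:
  assumes "x \<in> V" "x \<noteq> y"
  shows "deg x * hit y (Suc n) x = (\<Sum>\<^sub>\<infinity>z\<in>V. b x z * hit y n z)"
  using assms avg_complement[OF assms(1), of "avoid V p y n"] avoid_bounds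
  by (simp add: hit_def deg_avg[symmetric])

text \<open>Reversibility: \<open>\<Sum>\<^sub>x deg x * (P f) x = \<Sum>\<^sub>z deg z * f z\<close> for the transition operator \<open>P\<close>. Hence
  each step of the recursion increases the total mass by at most \<open>deg y\<close>. This summability
  replaces finite support in Green's formula.\<close>

lemma deg_hit_summable:
  assumes "y \<in> V"
  shows "(\<lambda>x. deg x * hit y n x) summable_on V"
proof (induction n)
  case 0
  show ?case
    by (rule finite_nonzero_values_imp_summable_on)
       (rule finite_subset[of _ "{y}"], auto simp: hit_def split: if_splits)
next
  case (Suc n)
  have "(\<lambda>(x, z). b x z * hit y n z) summable_on V \<times> V"
    using Suc hit_bounds by (intro pair_summable_snd) auto
  then have "(\<lambda>x. \<Sum>\<^sub>\<infinity>z\<in>V. b x z * hit y n z) summable_on V"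
    by (rule summable_on_Sigma_banach)
  moreover have "(\<lambda>x. if x = y then deg y else 0) summable_on V"
    by (rule finite_nonzero_values_imp_summable_on)
       (rule finite_subset[of _ "{y}"], auto split: if_splits)
  ultimately have "(\<lambda>x. (if x = y then deg y else 0) + (\<Sum>\<^sub>\<infinity>z\<in>V. b x z * hit y n z)) summable_on V"
    by (intro summable_on_add)
  then show ?case
  proof (rule summable_on_comparison_test)
    fix x assume x: "x \<in> V"
    show "0 \<le> deg x * hit y (Suc n) x"
      using deg_pos[OF x] hit_bounds[OF x] by (simp add: less_imp_le)
    have "0 \<le> (\<Sum>\<^sub>\<infinity>z\<in>V. b x z * hit y n z)"
      using x b_nonneg hit_bounds by (intro infsum_nonneg) auto
    then show "deg x * hit y (Suc n) x
        \<le> (if x = y then deg y else 0) + (\<Sum>\<^sub>\<infinity>z\<in>V. b x z * hit y n z)"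
      using deg_hit_Suc[OF x, of y n] by (cases "x = y") (auto simp: hit_def)
  qed
qed

text \<open>Green's formula for \<open>f\<close> with itself. Expanding the square produces four double sums, which
  agree in pairs by symmetry of \<open>b\<close>; the summability of \<open>deg * f\<close> together with \<open>f \<le> 1\<close>
  makes each of them converge.\<close>

lemma energy_identity:
  fixes f :: "'a \<Rightarrow> real"
  assumes f: "\<And>x. x \<in> V \<Longrightarrow> 0 \<le> f x \<and> f x \<le> 1" and sum: "(\<lambda>x. deg x * f x) summable_on V"
  defines "L \<equiv> \<lambda>x. f x * (deg x * f x - (\<Sum>\<^sub>\<infinity>z\<in>V. b x z * f z))"
  shows "(\<lambda>(x, z). b x z * (f x - f z)\<^sup>2) summable_on V \<times> V"
    and "L summable_on V"
    and "(\<Sum>\<^sub>\<infinity>(x, z)\<in>V \<times> V. b x z * (f x - f z)\<^sup>2) = 2 * infsum L V"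
proof -
  have fst: "(\<lambda>(x, z). b x z * f x) summable_on V \<times> V"
    using f sum by (intro pair_summable_fst) auto
  have sq: "(\<lambda>(x, z). b x z * (f x * f x)) summable_on V \<times> V"
    using fst by (rule summable_on_comparison_test)
      (use f b_nonneg in \<open>auto intro!: mult_left_mono mult_left_le mult_nonneg_nonneg\<close>)
  have cross: "(\<lambda>(x, z). b x z * (f x * f z)) summable_on V \<times> V"
    using fst by (rule summable_on_comparison_test)
      (use f b_nonneg in \<open>auto intro!: mult_left_mono mult_left_le mult_nonneg_nonneg\<close>)
  define T where "T = (\<lambda>x z. b x z * (f x * f x) - b x z * (f x * f z))"
  have T: "(\<lambda>(x, z). T x z) summable_on V \<times> V"
    using summable_on_diff[OF sq cross] by (simp add: T_def case_prod_unfold)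
  have T': "(\<lambda>(x, z). T z x) summable_on V \<times> V"
    using T summable_pairs_swap[of T] by simp
  have split: "b x z * (f x - f z)\<^sup>2 = T x z + T z x" if "x \<in> V" "z \<in> V" for x z
    using b_sym[OF that] by (simp add: T_def power2_eq_square algebra_simps)
  have "(\<lambda>(x, z). T x z + T z x) summable_on V \<times> V"
    using summable_on_add[OF T T'] by (simp add: case_prod_unfold)
  then show "(\<lambda>(x, z). b x z * (f x - f z)\<^sup>2) summable_on V \<times> V"
    by (rule summable_on_cong[THEN iffD1, rotated]) (use split in auto)
  have row: "infsum (T x) V = L x" if x: "x \<in> V" for x
  proof -
    have "(\<lambda>z. b x z * f z) summable_on V"
      using b_summable[OF x] by (rule summable_on_comparison_test)
        (use x f b_nonneg in \<open>auto intro!: mult_left_le\<close>)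
    then have "((\<lambda>z. f x * f x * b x z - f x * (b x z * f z)) has_sum
        (f x * f x * deg x - f x * (\<Sum>\<^sub>\<infinity>z\<in>V. b x z * f z))) V"
      using deg_has_sum[OF x] by (intro has_sum_diff has_sum_cmult_right has_sum_infsum)
    then show ?thesis unfolding T_def L_def by (simp add: infsumI algebra_simps)
  qed
  have "(\<lambda>x. infsum (T x) V) summable_on V" by (rule summable_on_Sigma_banach[OF T])
  then show "L summable_on V"
    by (rule summable_on_cong[THEN iffD1, rotated]) (simp add: row)
  have "(\<Sum>\<^sub>\<infinity>(x, z)\<in>V \<times> V. b x z * (f x - f z)\<^sup>2) = (\<Sum>\<^sub>\<infinity>(x, z)\<in>V \<times> V. T x z + T z x)"
    by (rule infsum_cong) (use split in auto)
  also have "\<dots> = (\<Sum>\<^sub>\<infinity>(x, z)\<in>V \<times> V. T x z) + (\<Sum>\<^sub>\<infinity>(x, z)\<in>V \<times> V. T z x)"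
    using infsum_add[OF T T'] by (simp add: case_prod_unfold)
  also have "\<dots> = 2 * (\<Sum>\<^sub>\<infinity>(x, z)\<in>V \<times> V. T x z)"
    using infsum_pairs_swap[of T] by simp
  also have "(\<Sum>\<^sub>\<infinity>(x, z)\<in>V \<times> V. T x z) = (\<Sum>\<^sub>\<infinity>x\<in>V. infsum (T x) V)"
    using infsum_Sigma'_banach[OF T] by simp
  also have "\<dots> = infsum L V"
    by (rule infsum_cong) (rule row)
  finally show "(\<Sum>\<^sub>\<infinity>(x, z)\<in>V \<times> V. b x z * (f x - f z)\<^sup>2) = 2 * infsum L V" .
qed

text \<open>In the energy identity for the hitting probabilities the term at \<open>x \<noteq> y\<close> is nonpositive, because
  \<open>P (hit y n) x = hit y (Suc n) x\<close> is at least \<open>hit y n x\<close>. Only the term at \<open>y\<close> remains, and there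
  \<open>hit\<close> is \<open>1\<close>.\<close>

lemma hit_energy:
  assumes y: "y \<in> V"
  shows "(\<lambda>(x, z). b x z * (hit y n x - hit y n z)\<^sup>2) summable_on V \<times> V"
    and "(\<Sum>\<^sub>\<infinity>(x, z)\<in>V \<times> V. b x z * (hit y n x - hit y n z)\<^sup>2)
           \<le> 2 * (deg y * avg V p (avoid V p y n) y)"
proof -
  let ?L = "\<lambda>x. hit y n x * (deg x * hit y n x - (\<Sum>\<^sub>\<infinity>z\<in>V. b x z * hit y n z))"
  note id = energy_identity[where f = "hit y n", OF hit_bounds deg_hit_summable[OF y]]
  show "(\<lambda>(x, z). b x z * (hit y n x - hit y n z)\<^sup>2) summable_on V \<times> V"
    by (rule id(1))
  have off: "?L x \<le> 0" if x: "x \<in> V" "x \<noteq> y" for x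
  proof -
    have "hit y n x \<le> hit y (Suc n) x"
      using avoid_decreasing[OF x(1), of y n] unfolding hit_def by simp
    then have "deg x * hit y n x \<le> (\<Sum>\<^sub>\<infinity>z\<in>V. b x z * hit y n z)"
      using deg_pos[OF x(1)] unfolding deg_hit_Suc[OF x, symmetric] by simp
    then show ?thesis using hit_bounds[OF x(1), of y n] by (intro mult_nonneg_nonpos) auto
  qed
  have "(\<Sum>\<^sub>\<infinity>z\<in>V. b y z * hit y n z) = deg y * (1 - avg V p (avoid V p y n) y)"
    using avg_complement[OF y, of "avoid V p y n"] avoid_bounds
    by (simp add: deg_avg[OF y, symmetric] hit_def[abs_def])
  then have at: "?L y = deg y * avg V p (avoid V p y n) y"
    by (simp add: hit_def algebra_simps)
  have "infsum ?L V \<le> infsum ?L {y}"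
    by (rule infsum_mono_neutral) (use id(2) off y in auto)
  also have "\<dots> = deg y * avg V p (avoid V p y n) y" using at by simp
  finally show "(\<Sum>\<^sub>\<infinity>(x, z)\<in>V \<times> V. b x z * (hit y n x - hit y n z)\<^sup>2)
       \<le> 2 * (deg y * avg V p (avoid V p y n) y)"
    using id(3) by linarith
qed

end

section \<open>Flows of finite energy\<close>

context weighted_graph
begin

definition divergence :: "('a \<Rightarrow> 'a \<Rightarrow> complex) \<Rightarrow> 'a \<Rightarrow> complex" where
  "divergence \<psi> x = (\<Sum>\<^sub>\<infinity>z\<in>V. of_real (b x z) * \<psi> x z)"

text \<open>By antisymmetry of \<open>\<psi>\<close>, twice the sum of \<open>f * div \<psi>\<close> equals the sum of
  \<open>b x z * (f x - f z) * \<psi> x z\<close> over all pairs. The weighted inequality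
  \<open>2 * a * c \<le> t * a^2 + c^2 / t\<close> in each term takes the place of the Cauchy-Schwarz inequality;
  the parameter \<open>t\<close> is sent to infinity after the energy of \<open>f\<close> has been sent to zero.\<close>

lemma green_formula_bound:
  fixes f :: "'a \<Rightarrow> real" and \<psi> :: "'a \<Rightarrow> 'a \<Rightarrow> complex"
  assumes f: "\<And>x. x \<in> V \<Longrightarrow> 0 \<le> f x \<and> f x \<le> 1" and f_sum: "(\<lambda>x. deg x * f x) summable_on V"
    and antisym: "\<And>x z. x \<in> V \<Longrightarrow> z \<in> V \<Longrightarrow> \<psi> z x = - \<psi> x z"
    and \<psi>_energy: "(\<lambda>(x, z). b x z * (cmod (\<psi> x z))\<^sup>2) summable_on V \<times> V"
    and t: "0 < t"
  shows "4 * cmod (\<Sum>\<^sub>\<infinity>x\<in>V. of_real (f x) * divergence \<psi> x)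
    \<le> t * (\<Sum>\<^sub>\<infinity>(x, z)\<in>V \<times> V. b x z * (f x - f z)\<^sup>2)
      + (\<Sum>\<^sub>\<infinity>(x, z)\<in>V \<times> V. b x z * (cmod (\<psi> x z))\<^sup>2) / t"
proof -
  let ?E = "\<lambda>(x, z). b x z * (f x - f z)\<^sup>2" and ?C = "\<lambda>(x, z). b x z * (cmod (\<psi> x z))\<^sup>2"
  define T where "T = (\<lambda>x z. of_real (b x z) * (of_real (f x) * \<psi> x z))"
  have fst: "(\<lambda>(x, z). b x z * f x) summable_on V \<times> V"
    using f f_sum by (intro pair_summable_fst) auto
  have T_abs: "(\<lambda>u. norm ((\<lambda>(x, z). T x z) u)) summable_on V \<times> V"
  proof (rule Infinite_Sum.abs_summable_on_comparison_test')
    show "(\<lambda>u. (\<lambda>(x, z). b x z * f x) u + ?C u) summable_on V \<times> V"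
      by (rule summable_on_add[OF fst \<psi>_energy])
    fix u assume "u \<in> V \<times> V"
    then obtain x z where u: "u = (x, z)" "x \<in> V" "z \<in> V" by auto
    have "0 \<le> (f x - cmod (\<psi> x z))\<^sup>2" by simp
    then have "2 * (f x * cmod (\<psi> x z)) \<le> (f x)\<^sup>2 + (cmod (\<psi> x z))\<^sup>2"
      by (simp add: power2_diff)
    moreover have "(f x)\<^sup>2 \<le> f x"
      using f[OF u(2)] by (simp add: power2_eq_square mult_left_le)
    moreover have "0 \<le> f x * cmod (\<psi> x z)" using f[OF u(2)] by simp
    ultimately have "f x * cmod (\<psi> x z) \<le> f x + (cmod (\<psi> x z))\<^sup>2" by linarith
    then have "b x z * (f x * cmod (\<psi> x z)) \<le> b x z * (f x + (cmod (\<psi> x z))\<^sup>2)"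
      using b_nonneg[OF u(2,3)] by (rule mult_left_mono)
    then show "norm ((\<lambda>(x, z). T x z) u) \<le> (\<lambda>(x, z). b x z * f x) u + ?C u"
      using u f b_nonneg by (simp add: T_def norm_mult distrib_left)
  qed
  have T: "(\<lambda>(x, z). T x z) summable_on V \<times> V" by (rule abs_summable_summable[OF T_abs])
  have T': "(\<lambda>(x, z). T z x) summable_on V \<times> V"
    using T summable_pairs_swap[of T] by simp
  have swap: "(\<Sum>\<^sub>\<infinity>(x, z)\<in>V \<times> V. T z x) = (\<Sum>\<^sub>\<infinity>(x, z)\<in>V \<times> V. T x z)"
    by (rule infsum_pairs_swap)
  have row: "infsum (T x) V = of_real (f x) * divergence \<psi> x" for x
    unfolding T_def divergence_def infsum_cmult_right'[symmetric]
    by (rule infsum_cong) simp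
  have "(\<Sum>\<^sub>\<infinity>x\<in>V. of_real (f x) * divergence \<psi> x) = (\<Sum>\<^sub>\<infinity>(x, z)\<in>V \<times> V. T x z)"
    using infsum_Sigma'_banach[OF T] by (simp add: row)
  then have "2 * (\<Sum>\<^sub>\<infinity>x\<in>V. of_real (f x) * divergence \<psi> x)
      = (\<Sum>\<^sub>\<infinity>(x, z)\<in>V \<times> V. T x z) + (\<Sum>\<^sub>\<infinity>(x, z)\<in>V \<times> V. T z x)"
    unfolding swap by simp
  also have "\<dots> = (\<Sum>\<^sub>\<infinity>u\<in>V \<times> V. (\<lambda>(x, z). T x z) u + (\<lambda>(x, z). T z x) u)"
    by (rule infsum_add[OF T T', symmetric])
  finally have "2 * cmod (\<Sum>\<^sub>\<infinity>x\<in>V. of_real (f x) * divergence \<psi> x)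
      = cmod (\<Sum>\<^sub>\<infinity>u\<in>V \<times> V. (\<lambda>(x, z). T x z) u + (\<lambda>(x, z). T z x) u)"
    by (metis norm_mult norm_numeral)
  also have "\<dots> \<le> (\<Sum>\<^sub>\<infinity>u\<in>V \<times> V. t / 2 * ?E u + 1 / (2 * t) * ?C u)"
  proof (rule norm_infsum_le)
    have E: "?E summable_on V \<times> V" by (rule energy_identity(1)[OF f f_sum])
    have "(\<lambda>u. t / 2 * ?E u + 1 / (2 * t) * ?C u) summable_on V \<times> V"
      by (intro summable_on_add summable_on_cmult_right E \<psi>_energy)
    then show "((\<lambda>u. t / 2 * ?E u + 1 / (2 * t) * ?C u) has_sum
        (\<Sum>\<^sub>\<infinity>u\<in>V \<times> V. t / 2 * ?E u + 1 / (2 * t) * ?C u)) (V \<times> V)"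
      by (rule has_sum_infsum)
    show "((\<lambda>u. (\<lambda>(x, z). T x z) u + (\<lambda>(x, z). T z x) u) has_sum
        (\<Sum>\<^sub>\<infinity>u\<in>V \<times> V. (\<lambda>(x, z). T x z) u + (\<lambda>(x, z). T z x) u)) (V \<times> V)"
      by (rule has_sum_infsum[OF summable_on_add[OF T T']])
    fix u assume "u \<in> V \<times> V"
    then obtain x z where u: "u = (x, z)" "x \<in> V" "z \<in> V" by auto
    have "T x z + T z x = of_real (b x z * (f x - f z)) * \<psi> x z"
      using antisym[OF u(2,3)] b_sym[OF u(2,3)] by (simp add: T_def algebra_simps)
    then have eq: "cmod (T x z + T z x) = b x z * (\<bar>f x - f z\<bar> * cmod (\<psi> x z))"
      using b_nonneg[OF u(2,3)] by (simp only: norm_mult norm_of_real abs_mult abs_of_nonneg mult.assoc)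
    have "0 \<le> (t * \<bar>f x - f z\<bar> - cmod (\<psi> x z))\<^sup>2 / (2 * t)" using t by simp
    also have "\<dots> = t / 2 * (f x - f z)\<^sup>2 + 1 / (2 * t) * (cmod (\<psi> x z))\<^sup>2
        - \<bar>f x - f z\<bar> * cmod (\<psi> x z)"
      using t by (simp add: power2_diff power_mult_distrib field_simps)
         (simp add: power2_eq_square algebra_simps)
    finally have "\<bar>f x - f z\<bar> * cmod (\<psi> x z)
        \<le> t / 2 * (f x - f z)\<^sup>2 + 1 / (2 * t) * (cmod (\<psi> x z))\<^sup>2" by simp
    then have "b x z * (\<bar>f x - f z\<bar> * cmod (\<psi> x z))
        \<le> b x z * (t / 2 * (f x - f z)\<^sup>2 + 1 / (2 * t) * (cmod (\<psi> x z))\<^sup>2)"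
      using b_nonneg[OF u(2,3)] by (rule mult_left_mono)
    then show "norm ((\<lambda>(x, z). T x z) u + (\<lambda>(x, z). T z x) u)
        \<le> t / 2 * ?E u + 1 / (2 * t) * ?C u"
      unfolding u(1) by (simp add: eq algebra_simps)
  qed
  also have "\<dots> = t / 2 * infsum ?E (V \<times> V) + 1 / (2 * t) * infsum ?C (V \<times> V)"
    using energy_identity(1)[OF f f_sum] \<psi>_energy
    by (intro infsumI has_sum_add has_sum_cmult_right has_sum_infsum)
  finally show ?thesis using t by (simp add: field_simps)
qed

text \<open>The hitting probabilities are test functions that increase to \<open>1\<close> while their energy tends to
  \<open>0\<close>. They are inserted into the preceding bound.\<close>

lemma vanishing_avoidance_imp_flow_balanced:
  fixes \<psi> :: "'a \<Rightarrow> 'a \<Rightarrow> complex"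
  assumes y: "y \<in> V"
    and vanish: "\<And>x. x \<in> V \<Longrightarrow> (\<lambda>n. avg V p (avoid V p y n) x) \<longlonglongrightarrow> 0"
    and antisym: "\<And>x z. x \<in> V \<Longrightarrow> z \<in> V \<Longrightarrow> \<psi> z x = - \<psi> x z"
    and \<psi>_energy: "(\<lambda>(x, z). b x z * (cmod (\<psi> x z))\<^sup>2) summable_on V \<times> V"
    and div: "divergence \<psi> summable_on V"
  shows "infsum (divergence \<psi>) V = 0"
proof -
  let ?E = "\<lambda>n. (\<Sum>\<^sub>\<infinity>(x, z)\<in>V \<times> V. b x z * (hit y n x - hit y n z)\<^sup>2)"
  define C where "C = (\<Sum>\<^sub>\<infinity>(x, z)\<in>V \<times> V. b x z * (cmod (\<psi> x z))\<^sup>2)"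
  have "0 \<le> C" unfolding C_def using b_nonneg by (intro infsum_nonneg) auto
  have hit_lim: "(\<lambda>n. hit y n x) \<longlonglongrightarrow> 1" if x: "x \<in> V" for x
  proof (cases "x = y")
    case False
    then have "(\<lambda>n. avoid V p y (Suc n) x) \<longlonglongrightarrow> 0" using vanish[OF x] by simp
    then have "(\<lambda>n. avoid V p y n x) \<longlonglongrightarrow> 0" by (rule LIMSEQ_imp_Suc)
    then show ?thesis unfolding hit_def using tendsto_diff[OF tendsto_const, of _ 0 _ 1] by force
  qed (simp add: hit_def)
  have sum_lim: "(\<lambda>n. \<Sum>\<^sub>\<infinity>x\<in>V. of_real (hit y n x) * divergence \<psi> x) \<longlonglongrightarrow> infsum (divergence \<psi>) V"
  proof (rule infsum_tendsto_dominated[where h = "\<lambda>x. norm (divergence \<psi> x)"])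
    show "(\<lambda>n. of_real (hit y n x) * divergence \<psi> x) \<longlonglongrightarrow> divergence \<psi> x" if "x \<in> V" for x
      using tendsto_mult_right[OF tendsto_of_real[OF hit_lim[OF that]], of "divergence \<psi> x"] by simp
    show "norm (of_real (hit y n x) * divergence \<psi> x) \<le> norm (divergence \<psi> x)" if "x \<in> V" for n x
      using hit_bounds[OF that, of y n] by (simp add: norm_mult mult_left_le_one_le)
    show "(\<lambda>x. norm (divergence \<psi> x)) summable_on V"
      using div summable_on_iff_abs_summable_on_complex by blast
  qed
  have E_lim: "?E \<longlonglongrightarrow> 0"
  proof (rule tendsto_sandwich[OF _ _ tendsto_const])
    show "(\<lambda>n. 2 * (deg y * avg V p (avoid V p y n) y)) \<longlonglongrightarrow> 0"
      using tendsto_mult_left[OF vanish[OF y], of "2 * deg y"] by (simp add: mult.assoc)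
    show "\<forall>\<^sub>F n in sequentially. 0 \<le> ?E n"
      using b_nonneg by (intro always_eventually allI infsum_nonneg) auto
    show "\<forall>\<^sub>F n in sequentially. ?E n \<le> 2 * (deg y * avg V p (avoid V p y n) y)"
      using hit_energy(2)[OF y] by (intro always_eventually allI)
  qed
  \<comment> \<open>The bound \<open>s \<le> C / t\<close> for all \<open>t > 0\<close> forces \<open>s = 0\<close>.\<close>
  define s where "s = 4 * cmod (infsum (divergence \<psi>) V)"
  have bound: "s \<le> C / t" if t: "0 < t" for t
  proof (rule LIMSEQ_le)
    show "(\<lambda>n. 4 * cmod (\<Sum>\<^sub>\<infinity>x\<in>V. of_real (hit y n x) * divergence \<psi> x)) \<longlonglongrightarrow> s"
      unfolding s_def by (intro tendsto_mult_left tendsto_norm sum_lim)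
    show "(\<lambda>n. t * ?E n + C / t) \<longlonglongrightarrow> C / t"
      using tendsto_add[OF tendsto_mult_left[OF E_lim, of t] tendsto_const[of "C / t"]] by simp
    show "\<exists>N. \<forall>n\<ge>N. 4 * cmod (\<Sum>\<^sub>\<infinity>x\<in>V. of_real (hit y n x) * divergence \<psi> x) \<le> t * ?E n + C / t"
      unfolding C_def
      using green_formula_bound[OF hit_bounds deg_hit_summable[OF y] antisym \<psi>_energy t] by blast
  qed
  have "s = 0"
  proof (rule ccontr)
    assume "s \<noteq> 0"
    then have "0 < s" by (simp add: s_def)
    then show False
      using bound[of "(C + 1) / s"] \<open>0 \<le> C\<close> by (simp add: field_simps)
  qed
  then show ?thesis by (simp add: s_def)
qed

text \<open>The minimum principle: if the average of a nonnegative function over the neighbours of a vertex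
  vanishes, then the function vanishes at all these neighbours.\<close>

lemma harmonic_zero_propagates:
  assumes harm: "\<And>x. x \<in> V \<Longrightarrow> q x = avg V p q x"
    and q: "\<And>x. x \<in> V \<Longrightarrow> 0 \<le> q x \<and> q x \<le> 1"
    and y: "y \<in> V" "q y = 0" and x: "x \<in> V"
  shows "q x = 0"
  using connected[OF y(1) x]
proof (induction rule: rtranclp_induct)
  case (step u v)
  then have uv: "u \<in> V" "v \<in> V" "0 < b u v" by auto
  have "p u v * q v = 0"
  proof (rule nonneg_infsum_le_0D[where f = "\<lambda>z. p u z * q z" and A = V])
    show "(\<Sum>\<^sub>\<infinity>z\<in>V. p u z * q z) \<le> 0" using harm[OF uv(1)] step.IH by (simp add: avg_def)
    show "(\<lambda>z. p u z * q z) summable_on V" by (rule avg_summable[OF uv(1) q])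
    show "0 \<le> p u z * q z" if "z \<in> V" for z using p_nonneg[OF uv(1) that] q[OF that] by simp
  qed fact
  then show ?case using uv deg_pos[OF uv(1)] by (simp add: p_eq)
qed (rule y)

text \<open>The potential \<open>q\<close> is the limit of \<open>avoid V p y n\<close>, the probability of never visiting \<open>y\<close>. It satisfies
  \<open>q = P q\<close> away from \<open>y\<close>, and \<open>c = - deg y * P q y\<close>. If \<open>P q y\<close> were \<open>0 = q y\<close>, then \<open>q\<close> would
  be harmonic everywhere and vanish at \<open>y\<close>, hence vanish identically.\<close>

lemma persistent_avoidance_imp_potential:
  assumes x0: "x0 \<in> V" and y: "y \<in> V"
    and persist: "\<not> (\<lambda>n. avg V p (avoid V p y n) x0) \<longlonglongrightarrow> 0"
  obtains q :: "'a \<Rightarrow> real" and c :: real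
  where "c \<noteq> 0"
    and "(\<lambda>(x, z). b x z * (q x - q z)\<^sup>2) summable_on V \<times> V"
    and "\<And>x. x \<in> V \<Longrightarrow> ((\<lambda>z. b x z * (q x - q z)) has_sum (if x = y then c else 0)) V"
proof -
  define q where "q = (\<lambda>x. lim (\<lambda>n. avoid V p y n x))"
  have q_lim: "(\<lambda>n. avoid V p y n x) \<longlonglongrightarrow> q x" if "x \<in> V" for x
    unfolding q_def by (rule avoid_tendsto[OF that])
  have q: "0 \<le> q x \<and> q x \<le> 1" if "x \<in> V" for x
    using LIMSEQ_le_const[OF q_lim[OF that], of 0] LIMSEQ_le_const2[OF q_lim[OF that], of 1]
      avoid_bounds[OF that] by blast
  have avg_lim: "(\<lambda>n. avg V p (avoid V p y n) x) \<longlonglongrightarrow> avg V p q x" if "x \<in> V" for x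
    by (rule avg_tendsto[OF that avoid_bounds q_lim])
  have q_y: "q y = 0" unfolding q_def by simp
  have harm: "q x = avg V p q x" if x: "x \<in> V" "x \<noteq> y" for x
    using LIMSEQ_unique[OF LIMSEQ_Suc[OF q_lim[OF x(1)]]] avg_lim[OF x(1)] x(2) by simp
  have "avg V p q y \<noteq> 0"
  proof
    assume "avg V p q y = 0"
    then have "q x = avg V p q x" if "x \<in> V" for x using harm[OF that] q_y by metis
    then have "q x = 0" if "x \<in> V" for x
      using harmonic_zero_propagates[where q = q, OF _ q y q_y that] by blast
    then have "avg V p q x0 = 0" unfolding avg_def by (intro infsum_0) simp
    then show False using avg_lim[OF x0] persist by simp
  qed
  \<comment> \<open>Fatou's lemma: finite partial sums are limits of partial sums of energies of hitting
    probabilities, which are bounded uniformly in \<open>n\<close>.\<close>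
  have pair: "(\<lambda>(x, z). b x z * (q x - q z)\<^sup>2) summable_on V \<times> V"
  proof (rule nonneg_bdd_above_summable_on)
    show "0 \<le> (case u of (x, z) \<Rightarrow> b x z * (q x - q z)\<^sup>2)" if "u \<in> V \<times> V" for u
      using that b_nonneg by auto
    have "(\<Sum>(x, z)\<in>F. b x z * (q x - q z)\<^sup>2) \<le> 2 * deg y" if F: "F \<subseteq> V \<times> V" "finite F" for F
    proof (rule LIMSEQ_le_const2)
      show "(\<lambda>n. \<Sum>(x, z)\<in>F. b x z * (avoid V p y n x - avoid V p y n z)\<^sup>2)
          \<longlonglongrightarrow> (\<Sum>(x, z)\<in>F. b x z * (q x - q z)\<^sup>2)"
        unfolding case_prod_unfold using F q_lim
        by (intro tendsto_sum tendsto_mult_left tendsto_power tendsto_diff) auto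
      have "(\<Sum>(x, z)\<in>F. b x z * (avoid V p y n x - avoid V p y n z)\<^sup>2) \<le> 2 * deg y" for n
      proof -
        have "(\<Sum>(x, z)\<in>F. b x z * (avoid V p y n x - avoid V p y n z)\<^sup>2)
            = (\<Sum>(x, z)\<in>F. b x z * (hit y n x - hit y n z)\<^sup>2)"
          by (rule sum.cong) (auto simp: hit_def power2_commute)
        also have "\<dots> \<le> (\<Sum>\<^sub>\<infinity>(x, z)\<in>V \<times> V. b x z * (hit y n x - hit y n z)\<^sup>2)"
          using F b_nonneg by (intro finite_sum_le_infsum hit_energy(1)[OF y]) auto
        also have "\<dots> \<le> 2 * (deg y * avg V p (avoid V p y n) y)"
          by (rule hit_energy(2)[OF y])
        also have "\<dots> \<le> 2 * deg y"
          using deg_pos[OF y] avg_bounds(2)[where f = "avoid V p y n", OF y avoid_bounds] by (simp add: mult_left_le)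
        finally show ?thesis .
      qed
      then show "\<exists>N. \<forall>n\<ge>N. (\<Sum>(x, z)\<in>F. b x z * (avoid V p y n x - avoid V p y n z)\<^sup>2) \<le> 2 * deg y"
        by blast
    qed
    then show "bdd_above (sum (\<lambda>(x, z). b x z * (q x - q z)\<^sup>2) ` {F. F \<subseteq> V \<times> V \<and> finite F})"
      by (intro bdd_aboveI[of _ "2 * deg y"]) auto
  qed
  have div: "((\<lambda>z. b x z * (q x - q z)) has_sum (if x = y then - deg y * avg V p q y else 0)) V"
    if x: "x \<in> V" for x
  proof -
    have "(\<lambda>z. b x z * q z) summable_on V"
      using b_summable[OF x] by (rule summable_on_comparison_test)
        (use x q b_nonneg in \<open>auto intro!: mult_left_le\<close>)
    then have "((\<lambda>z. b x z * q x - b x z * q z) has_sum (deg x * q x - (\<Sum>\<^sub>\<infinity>z\<in>V. b x z * q z))) V"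
      using deg_has_sum[OF x] by (intro has_sum_diff has_sum_cmult_left has_sum_infsum)
    then have "((\<lambda>z. b x z * (q x - q z)) has_sum (deg x * q x - deg x * avg V p q x)) V"
      by (simp add: deg_avg[OF x] right_diff_distrib)
    then show ?thesis using harm[OF x] q_y by auto
  qed
  show ?thesis
    using that[of "- deg y * avg V p q y" q] pair div \<open>avg V p q y \<noteq> 0\<close> deg_pos[OF y] by simp
qed

end

section \<open>Recurrence in terms of avoidance probabilities\<close>

text \<open>A vertex may have infinitely many neighbours, but summability of the weights allows only
  countably many, so components are countable even if the vertex set is not.\<close>

lemma countable_rtranclp_reachable:
  assumes "\<And>u. countable {v. R u v}"
  shows "countable {v. R\<^sup>*\<^sup>* u v}"
proof -
  have "countable {v. (R ^^ n) u v}" for n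
  proof (induction n)
    case 0
    have "{v. (R ^^ 0) u v} = {u}" by auto
    then show ?case by simp
  next
    case (Suc n)
    have "{v. (R ^^ Suc n) u v} = (\<Union>w\<in>{w. (R ^^ n) u w}. {v. R w v})" by auto
    then show ?case using Suc assms by simp
  qed
  moreover have "{v. R\<^sup>*\<^sup>* u v} = (\<Union>n. {v. (R ^^ n) u v})" by (auto simp: rtranclp_power)
  ultimately show ?thesis by simp
qed

context weighted_graph
begin

lemma countable_vertices: "countable V"
proof (cases "V = {}")
  case False
  then obtain v where v: "v \<in> V" by blast
  let ?R = "\<lambda>u w. u \<in> V \<and> w \<in> V \<and> 0 < b u w"
  have "countable {w. ?R u w}" for u
  proof (cases "u \<in> V")
    case True
    have "countable {w\<in>V. b u w \<noteq> 0}" by (rule summable_countable_real[OF b_summable[OF True]])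
    then show ?thesis by (rule countable_subset[rotated]) auto
  qed simp
  then have "countable {w. ?R\<^sup>*\<^sup>* v w}" by (rule countable_rtranclp_reachable)
  then show ?thesis by (rule countable_subset[rotated]) (use connected[OF v] in blast)
qed simp

lemma recurrent_graph_iff_avoidance_vanishes:
  assumes "\<nexists>v. V = {v}"
  shows "recurrent_graph V b \<longleftrightarrow>
    (\<forall>x\<in>V. \<forall>y\<in>V. (\<lambda>n. avg V p (avoid V p y n) x) \<longlonglongrightarrow> 0)"
proof
  assume "recurrent_graph V b"
  then have *: "\<forall>x\<in>V. \<forall>y\<in>V. \<exists>(M :: (nat \<Rightarrow> 'a) measure) Y.
      markov_chain V p M Y \<and> \<P>(\<omega> in M. Y 0 \<omega> = x) > 0 \<and>
      \<P>(\<omega> in M. (\<exists>k>0. Y k \<omega> = y) \<bar> Y 0 \<omega> = x) = 1"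
    using assms unfolding recurrent_graph_def by blast
  show "\<forall>x\<in>V. \<forall>y\<in>V. (\<lambda>n. avg V p (avoid V p y n) x) \<longlonglongrightarrow> 0"
  proof (intro ballI)
    fix x y assume xy: "x \<in> V" "y \<in> V"
    then obtain M :: "(nat \<Rightarrow> 'a) measure" and Y
      where MY: "markov_chain V p M Y" "\<P>(\<omega> in M. Y 0 \<omega> = x) > 0"
        and one: "\<P>(\<omega> in M. (\<exists>k>0. Y k \<omega> = y) \<bar> Y 0 \<omega> = x) = 1"
      using * by blast
    show "(\<lambda>n. avg V p (avoid V p y n) x) \<longlonglongrightarrow> 0"
      using return_prob_eq_1_iff[OF MY(1) countable_vertices xy MY(2)] one by blast
  qed
next
  assume *: "\<forall>x\<in>V. \<forall>y\<in>V. (\<lambda>n. avg V p (avoid V p y n) x) \<longlonglongrightarrow> 0"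
  have "\<exists>(M :: (nat \<Rightarrow> 'a) measure) Y. markov_chain V p M Y \<and> \<P>(\<omega> in M. Y 0 \<omega> = x) > 0 \<and>
      \<P>(\<omega> in M. (\<exists>k>0. Y k \<omega> = y) \<bar> Y 0 \<omega> = x) = 1" if "x \<in> V" "y \<in> V" for x y
  proof -
    obtain M :: "(nat \<Rightarrow> 'a) measure" and Y
      where MY: "markov_chain V p M Y" "\<P>(\<omega> in M. Y 0 \<omega> = x) > 0"
      by (rule markov_chain_exists[OF countable_vertices \<open>x \<in> V\<close>])
    then show ?thesis using return_prob_eq_1_iff[OF MY(1) countable_vertices that MY(2)] * that by blast
  qed
  then show "recurrent_graph V b" unfolding recurrent_graph_def by blast
qed

end

section \<open>Connected components\<close>

locale symmetric_graph =
  fixes L :: "'a set" and b :: "'a \<Rightarrow> 'a \<Rightarrow> real"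
  assumes nonneg: "v \<in> L \<Longrightarrow> w \<in> L \<Longrightarrow> 0 \<le> b v w"
    and sym: "v \<in> L \<Longrightarrow> w \<in> L \<Longrightarrow> b v w = b w v"
    and no_loop: "v \<in> L \<Longrightarrow> b v v = 0"
    and summable: "v \<in> L \<Longrightarrow> b v summable_on L"
begin

abbreviation edge where "edge v w \<equiv> v \<in> L \<and> w \<in> L \<and> 0 < b v w"
abbreviation components where "components \<equiv> connected_components_of_graph L b"

lemma edge_rtranclp_sym: "edge\<^sup>*\<^sup>* v w \<Longrightarrow> edge\<^sup>*\<^sup>* w v"
proof (induction rule: rtranclp_induct)
  case (step u w)
  then have "edge w u" using sym by auto
  then show ?case using step.IH by (rule converse_rtranclp_into_rtranclp)
qed simp

lemma component_obtain:
  assumes "V \<in> components"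
  obtains v where "v \<in> L" "V = {w. edge\<^sup>*\<^sup>* v w}"
  using assms unfolding connected_components_of_graph_def by blast

lemma component_subset: "V \<in> components \<Longrightarrow> V \<subseteq> L"
proof
  fix w assume "V \<in> components" "w \<in> V"
  then obtain v where "edge\<^sup>*\<^sup>* v w" "v \<in> L" using component_obtain by blast
  then show "w \<in> L" by (induction rule: rtranclp_induct) auto
qed

lemma component_closed:
  assumes "V \<in> components" "v \<in> V" "w \<in> L" "b v w \<noteq> 0"
  shows "w \<in> V"
proof -
  have v: "v \<in> L" using component_subset assms by blast
  then have "edge v w" using assms nonneg[of v w] by auto
  moreover obtain u where "V = {w. edge\<^sup>*\<^sup>* u w}" using component_obtain[OF assms(1)] by blast
  ultimately show ?thesis using assms(2) by (auto intro: rtranclp.rtrancl_into_rtrancl)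
qed

lemma component_eq:
  assumes "V \<in> components" "v \<in> V"
  shows "V = {w. edge\<^sup>*\<^sup>* v w}"
proof -
  obtain u where u: "V = {w. edge\<^sup>*\<^sup>* u w}" using component_obtain[OF assms(1)] by blast
  then have "edge\<^sup>*\<^sup>* u v" using assms(2) by simp
  then show ?thesis using u edge_rtranclp_sym by (auto intro: rtranclp_trans)
qed

lemma components_cover: "\<Union>components = L"
proof
  show "\<Union>components \<subseteq> L" using component_subset by blast
  show "L \<subseteq> \<Union>components" unfolding connected_components_of_graph_def by auto
qed

text \<open>A path that starts in a component stays in it, hence components are connected in themselves.
  A component with a second vertex has no isolated vertices.\<close>

lemma component_weighted_graph:
  assumes V: "V \<in> components" and nontrivial: "\<nexists>v. V = {v}"
  shows "weighted_graph V b"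
proof
  note sub = component_subset[OF V]
  show "0 \<le> b x z" if "x \<in> V" "z \<in> V" for x z using that sub nonneg by blast
  show "b x z = b z x" if "x \<in> V" "z \<in> V" for x z using that sub sym by blast
  show "b x summable_on V" if "x \<in> V" for x
    using summable_on_subset_banach[OF summable sub] that sub by blast
  have path: "(\<lambda>u v. u \<in> V \<and> v \<in> V \<and> 0 < b u v)\<^sup>*\<^sup>* x z" if x: "x \<in> V" and z: "z \<in> V" for x z
  proof -
    have "edge\<^sup>*\<^sup>* x z" using component_eq[OF V x] z by simp
    then have "(\<lambda>u v. u \<in> V \<and> v \<in> V \<and> 0 < b u v)\<^sup>*\<^sup>* x z \<and> z \<in> V"
    proof (induction rule: rtranclp_induct)
      case (step u w)
      then have "w \<in> V" using component_closed[OF V, of u w] by auto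
      then show ?case using step by (auto intro: rtranclp.rtrancl_into_rtrancl)
    qed (use x in simp)
    then show ?thesis by blast
  qed
  then show "(\<lambda>u v. u \<in> V \<and> v \<in> V \<and> 0 < b u v)\<^sup>*\<^sup>* x z" if "x \<in> V" "z \<in> V" for x z using that by blast
  show "\<exists>z\<in>V. 0 < b x z" if x: "x \<in> V" for x
  proof -
    obtain z where "z \<in> V" "z \<noteq> x" using nontrivial x by blast
    from path[OF x \<open>z \<in> V\<close>] show ?thesis
      by (cases rule: converse_rtranclpE) (use \<open>z \<noteq> x\<close> in blast)+
  qed
qed

end

section \<open>The boundary operator as divergence on the link graph\<close>

lemma is_face_iff: "is_face \<tau> \<sigma> \<longleftrightarrow> (\<exists>a. a \<notin> \<tau> \<and> \<sigma> = insert a \<tau>)"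
proof
  assume "is_face \<tau> \<sigma>"
  then obtain a where "\<tau> \<subseteq> \<sigma>" "\<sigma> - \<tau> = {a}"
    unfolding is_face_def using card_1_singletonE by metis
  then have "a \<notin> \<tau> \<and> \<sigma> = insert a \<tau>" by blast
  then show "\<exists>a. a \<notin> \<tau> \<and> \<sigma> = insert a \<tau>" ..
next
  assume "\<exists>a. a \<notin> \<tau> \<and> \<sigma> = insert a \<tau>"
  then obtain a where "a \<notin> \<tau>" "\<sigma> = insert a \<tau>" by blast
  moreover from this have "\<sigma> - \<tau> = {a}" by blast
  ultimately show "is_face \<tau> \<sigma>" unfolding is_face_def by auto
qed

lemma is_face_insert: "is_face \<tau> (insert v \<tau>) \<longleftrightarrow> v \<notin> \<tau>"
  by (cases "v \<in> \<tau>") (auto simp: is_face_def insert_Diff_if insert_absorb)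

text \<open>Closedness under subsets is replaced by closedness under intervals \<open>\<tau> \<subseteq> \<kappa> \<subseteq> \<sigma>\<close>, which
  holds whether or not the empty simplex has been removed.\<close>

locale weighted_complex =
  fixes \<Sigma> :: "'a set set" and m :: "'a set \<Rightarrow> real"
    and \<delta> :: "('a set \<Rightarrow> complex) \<Rightarrow> 'a set \<Rightarrow> complex" and \<rho> :: "'a set"
  assumes finite_simplex: "\<sigma> \<in> \<Sigma> \<Longrightarrow> finite \<sigma>"
    and m_pos: "\<sigma> \<in> \<Sigma> \<Longrightarrow> 0 < m \<sigma>"
    and interval_closed: "\<tau> \<in> \<Sigma> \<Longrightarrow> \<sigma> \<in> \<Sigma> \<Longrightarrow> \<tau> \<subseteq> \<kappa> \<Longrightarrow> \<kappa> \<subseteq> \<sigma> \<Longrightarrow> \<kappa> \<in> \<Sigma>"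
    and locally_summable: "\<tau> \<in> \<Sigma> \<Longrightarrow> m summable_on {\<sigma>\<in>\<Sigma>. is_face \<tau> \<sigma>}"
    and coboundary: "coboundary_operator \<Sigma> \<delta>"
    and \<rho>: "\<rho> \<in> \<Sigma>"
begin

abbreviation \<theta> where "\<theta> \<equiv> theta \<delta>"
abbreviation bd where "bd \<equiv> boundary \<Sigma> m \<delta>"
abbreviation b where "b \<equiv> link_graph \<Sigma> m \<rho>"
abbreviation cofaces where "cofaces \<tau> \<equiv> {\<sigma>\<in>\<Sigma>. is_face \<tau> \<sigma>}"
abbreviation triangle where "triangle v w \<equiv> insert v (insert w \<rho>)"

definition lk :: "'a set" where "lk = {v. v \<notin> \<rho> \<and> insert v \<rho> \<in> \<Sigma>}"

definition adj :: "'a \<Rightarrow> 'a \<Rightarrow> bool" where "adj v w \<longleftrightarrow> v \<noteq> w \<and> triangle v w \<in> \<Sigma>"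

lemma adj_sym: "adj v w \<longleftrightarrow> adj w v"
  by (auto simp: adj_def insert_commute)

lemma b_eq: "b v w = (if adj v w then m (triangle v w) else 0)"
  by (auto simp: link_graph_def adj_def insert_commute)

lemma \<delta>_eq: "\<sigma> \<in> \<Sigma> \<Longrightarrow> \<delta> \<omega> \<sigma> = (\<Sum>\<tau> | \<tau> \<in> \<Sigma> \<and> is_face \<tau> \<sigma>. \<theta> \<tau> \<sigma> * \<omega> \<tau>)"
  using coboundary unfolding coboundary_operator_def by blast

lemma \<delta>_\<delta>: "\<sigma> \<in> \<Sigma> \<Longrightarrow> \<delta> (\<delta> \<omega>) \<sigma> = 0"
  using coboundary unfolding coboundary_operator_def by blast

lemma \<theta>_cases: "\<tau> \<in> \<Sigma> \<Longrightarrow> \<sigma> \<in> \<Sigma> \<Longrightarrow> is_face \<tau> \<sigma> \<Longrightarrow> \<theta> \<tau> \<sigma> = 1 \<or> \<theta> \<tau> \<sigma> = -1"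
  using coboundary unfolding coboundary_operator_def by blast

lemma \<theta>_square: "\<tau> \<in> \<Sigma> \<Longrightarrow> \<sigma> \<in> \<Sigma> \<Longrightarrow> is_face \<tau> \<sigma> \<Longrightarrow> \<theta> \<tau> \<sigma> * \<theta> \<tau> \<sigma> = 1"
  using \<theta>_cases by force

lemma cmod_\<theta>: "\<tau> \<in> \<Sigma> \<Longrightarrow> \<sigma> \<in> \<Sigma> \<Longrightarrow> is_face \<tau> \<sigma> \<Longrightarrow> cmod (\<theta> \<tau> \<sigma>) = 1"
  using \<theta>_cases by force

lemma finite_faces: "\<sigma> \<in> \<Sigma> \<Longrightarrow> finite {\<tau>. \<tau> \<in> \<Sigma> \<and> is_face \<tau> \<sigma>}"
  by (rule finite_subset[of _ "Pow \<sigma>"]) (use finite_simplex in \<open>auto simp: is_face_def\<close>)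

lemma lk_face: "v \<in> lk \<Longrightarrow> insert v \<rho> \<in> \<Sigma> \<and> is_face \<rho> (insert v \<rho>)"
  by (auto simp: lk_def is_face_iff)

lemma lk_triangle_face:
  "v \<in> lk \<Longrightarrow> w \<in> lk \<Longrightarrow> adj v w \<Longrightarrow> triangle v w \<in> \<Sigma> \<and> is_face (insert v \<rho>) (triangle v w)"
  by (auto simp: lk_def is_face_iff adj_def intro!: exI[of _ w])

lemma cofaces_\<rho>: "cofaces \<rho> = (\<lambda>v. insert v \<rho>) ` lk"
  by (auto simp: lk_def is_face_iff)

lemma inj_lk: "inj_on (\<lambda>v. insert v \<rho>) lk"
  unfolding inj_on_def lk_def by blast

lemma cofaces_lk:
  assumes v: "v \<in> lk"
  shows "cofaces (insert v \<rho>) = triangle v ` {w\<in>lk. adj v w}"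
proof
  show "cofaces (insert v \<rho>) \<subseteq> triangle v ` {w\<in>lk. adj v w}"
  proof
    fix \<tau> assume "\<tau> \<in> cofaces (insert v \<rho>)"
    then obtain w where w: "w \<notin> insert v \<rho>" "\<tau> = insert w (insert v \<rho>)" "\<tau> \<in> \<Sigma>"
      by (auto simp: is_face_iff)
    then have "insert w \<rho> \<in> \<Sigma>" using interval_closed[OF \<rho> w(3)] by blast
    then show "\<tau> \<in> triangle v ` {w\<in>lk. adj v w}"
      using w by (intro image_eqI[of _ _ w]) (auto simp: lk_def adj_def insert_commute)
  qed
qed (use lk_triangle_face[OF v] in auto)

lemma inj_triangle: "inj_on (triangle v) {w\<in>lk. adj v w}"
proof (rule inj_onI)
  fix x y assume xy: "x \<in> {w\<in>lk. adj v w}" "y \<in> {w\<in>lk. adj v w}" and eq: "triangle v x = triangle v y"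
  have "x \<in> triangle v x" by blast
  then have "x \<in> triangle v y" unfolding eq .
  then show "x = y" using xy by (auto simp: lk_def adj_def)
qed

lemma link_symmetric_graph: "symmetric_graph lk b"
proof
  show "0 \<le> b v w" for v w using m_pos by (auto simp: b_eq adj_def intro: less_imp_le)
  show "b v w = b w v" for v w using adj_sym by (auto simp: b_eq insert_commute)
  show "b v v = 0" for v by (simp add: b_eq adj_def)
  show "b v summable_on lk" if v: "v \<in> lk" for v
  proof -
    have "m summable_on triangle v ` {w\<in>lk. adj v w}"
      using locally_summable[of "insert v \<rho>"] lk_face[OF v] cofaces_lk[OF v] by simp
    then have "(m \<circ> triangle v) summable_on {w\<in>lk. adj v w}"
      using summable_on_reindex[OF inj_triangle] by blast
    then show ?thesis
      by (rule summable_on_cong_neutral[THEN iffD1, rotated -1]) (auto simp: b_eq)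
  qed
qed

definition flow :: "('a set \<Rightarrow> complex) \<Rightarrow> 'a \<Rightarrow> 'a \<Rightarrow> complex" where
  "flow \<omega> v w = (if adj v w
     then \<theta> \<rho> (insert v \<rho>) * \<theta> (insert v \<rho>) (triangle v w) * \<omega> (triangle v w) else 0)"

definition flow_div :: "('a set \<Rightarrow> complex) \<Rightarrow> 'a \<Rightarrow> complex" where
  "flow_div \<omega> v = (\<Sum>\<^sub>\<infinity>w\<in>lk. of_real (b v w) * flow \<omega> v w)"

text \<open>Exactly two faces of \<open>vw\<rho>\<close> contain \<open>\<rho>\<close>, namely \<open>v\<rho>\<close> and \<open>w\<rho>\<close>.\<close>

lemma sum_faces_triangle:
  assumes v: "v \<in> lk" and w: "w \<in> lk" and vw: "adj v w"
    and h: "\<And>\<kappa>. \<kappa> \<in> \<Sigma> \<Longrightarrow> \<not> is_face \<rho> \<kappa> \<Longrightarrow> h \<kappa> = 0"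
  shows "(\<Sum>\<kappa> | \<kappa> \<in> \<Sigma> \<and> is_face \<kappa> (triangle v w). \<theta> \<kappa> (triangle v w) * h \<kappa>)
       = \<theta> (insert v \<rho>) (triangle v w) * h (insert v \<rho>)
         + \<theta> (insert w \<rho>) (triangle v w) * h (insert w \<rho>)"
proof -
  have T: "triangle v w \<in> \<Sigma>" "is_face (insert v \<rho>) (triangle v w)"
    using lk_triangle_face[OF v w vw] by auto
  have T': "is_face (insert w \<rho>) (triangle v w)"
    using lk_triangle_face[OF w v] vw adj_sym by (simp add: insert_commute)
  have ne: "insert v \<rho> \<noteq> insert w \<rho>" using v w vw by (auto simp: lk_def adj_def)
  have "\<kappa> = insert v \<rho> \<or> \<kappa> = insert w \<rho>"
    if \<kappa>: "is_face \<kappa> (triangle v w)" and "is_face \<rho> \<kappa>" for \<kappa>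
  proof -
    obtain u where u: "u \<notin> \<rho>" "\<kappa> = insert u \<rho>" using \<open>is_face \<rho> \<kappa>\<close> unfolding is_face_iff by blast
    then have "u \<in> triangle v w" using \<kappa> unfolding is_face_def by blast
    then show ?thesis using u by blast
  qed
  then have "(\<Sum>\<kappa> | \<kappa> \<in> \<Sigma> \<and> is_face \<kappa> (triangle v w). \<theta> \<kappa> (triangle v w) * h \<kappa>)
      = (\<Sum>\<kappa>\<in>{insert v \<rho>, insert w \<rho>}. \<theta> \<kappa> (triangle v w) * h \<kappa>)"
    using T T' lk_face[OF v] lk_face[OF w] h
    by (intro sum.mono_neutral_right finite_faces) auto
  then show ?thesis using ne by simp
qed

text \<open>This is \<open>\<delta>\<delta> = 0\<close>, applied to the indicator function of \<open>\<rho>\<close> and evaluated at \<open>vw\<rho>\<close>.\<close>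

lemma \<theta>_antisym:
  assumes v: "v \<in> lk" and w: "w \<in> lk" and vw: "adj v w"
  shows "\<theta> \<rho> (insert w \<rho>) * \<theta> (insert w \<rho>) (triangle v w)
       = - (\<theta> \<rho> (insert v \<rho>) * \<theta> (insert v \<rho>) (triangle v w))"
proof -
  have T: "triangle v w \<in> \<Sigma>" using vw by (simp add: adj_def)
  have "\<delta> (indicator {\<rho>}) \<kappa> = 0" if "\<kappa> \<in> \<Sigma>" "\<not> is_face \<rho> \<kappa>" for \<kappa>
    unfolding \<delta>_eq[OF that(1)] using that(2) by (intro sum.neutral) (auto simp: indicator_def)
  then have "0 = \<theta> (insert v \<rho>) (triangle v w) * \<delta> (indicator {\<rho>}) (insert v \<rho>)
      + \<theta> (insert w \<rho>) (triangle v w) * \<delta> (indicator {\<rho>}) (insert w \<rho>)"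
    using sum_faces_triangle[OF v w vw, of "\<delta> (indicator {\<rho>})"] \<delta>_\<delta>[OF T, of "indicator {\<rho>}"]
    unfolding \<delta>_eq[OF T, of "\<delta> (indicator {\<rho>})"] by simp
  then show ?thesis
    by (simp add: theta_def[symmetric] mult.commute eq_neg_iff_add_eq_0 add.commute)
qed

lemma flow_antisym:
  assumes "v \<in> lk" "w \<in> lk"
  shows "flow \<omega> w v = - flow \<omega> v w"
proof (cases "adj v w")
  case True
  moreover have "triangle w v = triangle v w" by (rule insert_commute)
  ultimately show ?thesis using \<theta>_antisym[OF assms True] adj_sym by (simp add: flow_def)
qed (use adj_sym in \<open>simp add: flow_def\<close>)

text \<open>The cofaces of \<open>v\<rho>\<close> are parametrised by the neighbours of \<open>v\<close> in the link graph. Reindexing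
  and multiplication by a constant also preserve the default value of a divergent sum, so the
  equality holds for every \<open>\<omega>\<close>.\<close>

lemma boundary_eq_div:
  assumes v: "v \<in> lk"
  shows "of_real (m (insert v \<rho>)) * \<theta> \<rho> (insert v \<rho>) * bd \<omega> (insert v \<rho>) = flow_div \<omega> v"
proof -
  let ?f = "\<lambda>\<tau>. of_real (m \<tau>) * \<theta> (insert v \<rho>) \<tau> * \<omega> \<tau>"
  have "of_real (m (insert v \<rho>)) * bd \<omega> (insert v \<rho>) = infsum ?f (cofaces (insert v \<rho>))"
    using m_pos lk_face[OF v] by (force simp: boundary_def)
  also have "\<dots> = (\<Sum>\<^sub>\<infinity>w\<in>{w\<in>lk. adj v w}. ?f (triangle v w))"
    unfolding cofaces_lk[OF v] by (rule infsum_reindex[OF inj_triangle, unfolded o_def])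
  finally have "of_real (m (insert v \<rho>)) * \<theta> \<rho> (insert v \<rho>) * bd \<omega> (insert v \<rho>)
      = (\<Sum>\<^sub>\<infinity>w\<in>{w\<in>lk. adj v w}. \<theta> \<rho> (insert v \<rho>) * ?f (triangle v w))"
    unfolding infsum_cmult_right' by (metis mult.assoc mult.commute)
  also have "\<dots> = flow_div \<omega> v"
    unfolding flow_div_def by (rule infsum_cong_neutral) (auto simp: flow_def b_eq)
  finally show ?thesis .
qed

lemma boundary_boundary_eq: "of_real (m \<rho>) * bd (bd \<omega>) \<rho> = infsum (flow_div \<omega>) lk"
proof -
  let ?f = "\<lambda>\<tau>. of_real (m \<tau>) * \<theta> \<rho> \<tau> * bd \<omega> \<tau>"
  have "of_real (m \<rho>) * bd (bd \<omega>) \<rho> = infsum ?f (cofaces \<rho>)"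
    using m_pos[OF \<rho>] unfolding boundary_def[of _ _ _ "bd \<omega>"] by simp
  also have "\<dots> = infsum (?f \<circ> (\<lambda>v. insert v \<rho>)) lk"
    unfolding cofaces_\<rho> by (rule infsum_reindex[OF inj_lk])
  also have "\<dots> = infsum (flow_div \<omega>) lk"
    by (rule infsum_cong) (use boundary_eq_div in simp)
  finally show ?thesis .
qed

lemma cmod_div:
  assumes v: "v \<in> lk"
  shows "cmod (flow_div \<omega> v) = m (insert v \<rho>) * cmod (bd \<omega> (insert v \<rho>))"
  using lk_face[OF v] cmod_\<theta>[OF \<rho>] m_pos
  by (simp add: boundary_eq_div[OF v, symmetric] norm_mult less_imp_le)

lemma boundary_summable_iff_div_summable:
  "(\<lambda>\<sigma>. m \<sigma> * cmod (bd \<omega> \<sigma>)) summable_on cofaces \<rho> \<longleftrightarrow> flow_div \<omega> summable_on lk"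
proof -
  have "(\<lambda>\<sigma>. m \<sigma> * cmod (bd \<omega> \<sigma>)) summable_on cofaces \<rho> \<longleftrightarrow> (\<lambda>v. cmod (flow_div \<omega> v)) summable_on lk"
    unfolding cofaces_\<rho> summable_on_reindex[OF inj_lk]
    by (rule summable_on_cong) (simp add: cmod_div)
  then show ?thesis using summable_on_iff_abs_summable_on_complex by blast
qed

text \<open>The signs have modulus \<open>1\<close>, so the energy is the sum of \<open>m(\<tau>) |\<omega>(\<tau>)|\<^sup>2\<close> over the simplices
  \<open>\<tau> = vw\<rho>\<close>, each counted once for every ordered pair \<open>(v, w)\<close>.\<close>

lemma flow_energy:
  assumes "\<omega> \<in> ell2 \<Sigma> m"
  shows "(\<lambda>(v, w). b v w * (cmod (flow \<omega> v w))\<^sup>2) summable_on lk \<times> lk"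
proof -
  let ?A = "{(v, w). v \<in> lk \<and> w \<in> lk \<and> adj v w}"
  let ?g = "\<lambda>(v, w). triangle v w"
  have "(\<lambda>u. (\<lambda>\<tau>. m \<tau> * (cmod (\<omega> \<tau>))\<^sup>2) (?g u)) summable_on ?A"
  proof (rule summable_on_compose_finite_fibres[where N = 4 and B = \<Sigma> and g = ?g
        and f = "\<lambda>\<tau>. m \<tau> * (cmod (\<omega> \<tau>))\<^sup>2"])
    show "(\<lambda>\<tau>. m \<tau> * (cmod (\<omega> \<tau>))\<^sup>2) summable_on \<Sigma>" using assms by (simp add: ell2_def)
    show "0 \<le> m \<tau> * (cmod (\<omega> \<tau>))\<^sup>2" if "\<tau> \<in> \<Sigma>" for \<tau> using m_pos[OF that] by simp
    show "?g \<in> ?A \<rightarrow> \<Sigma>" by (auto simp: adj_def)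
    fix \<tau>
    show "finite {u\<in>?A. ?g u = \<tau>} \<and> card {u\<in>?A. ?g u = \<tau>} \<le> 4"
    proof (cases "{u\<in>?A. ?g u = \<tau>} = {}")
      case False
      then obtain v w where "\<tau> = triangle v w" by auto
      have sub: "{u\<in>?A. ?g u = \<tau>} \<subseteq> {v, w} \<times> {v, w}"
      proof
        fix u assume "u \<in> {u\<in>?A. ?g u = \<tau>}"
        then obtain x y where u: "u = (x, y)" "x \<in> lk" "y \<in> lk" and eq: "triangle x y = \<tau>" by auto
        have "x \<in> triangle x y" "y \<in> triangle x y" by blast+
        then have "x \<in> triangle v w" "y \<in> triangle v w" unfolding eq \<open>\<tau> = triangle v w\<close> .
        then show "u \<in> {v, w} \<times> {v, w}" using u by (auto simp: lk_def)
      qed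
      then have "card {u\<in>?A. ?g u = \<tau>} \<le> card ({v, w} \<times> {v, w})" by (intro card_mono) auto
      also have "\<dots> \<le> 2 * 2"
        unfolding card_cartesian_product using card_length[of "[v, w]"] by (intro mult_le_mono) auto
      finally show ?thesis using finite_subset[OF sub] by auto
    qed (simp only: finite.emptyI card.empty, simp)
  qed
  then show ?thesis
  proof (rule summable_on_cong_neutral[THEN iffD1, rotated -1])
    fix u assume "u \<in> ?A \<inter> (lk \<times> lk)"
    then obtain v w where u: "u = (v, w)" "v \<in> lk" "w \<in> lk" "adj v w" by auto
    then show "(\<lambda>\<tau>. m \<tau> * (cmod (\<omega> \<tau>))\<^sup>2) (?g u) = (case u of (v, w) \<Rightarrow> b v w * (cmod (flow \<omega> v w))\<^sup>2)"
      using lk_face[OF u(2)] lk_triangle_face[OF u(2-4)] cmod_\<theta> \<rho>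
      by (simp add: b_eq flow_def norm_mult)
  qed (auto simp: b_eq split: if_splits)
qed

end

section \<open>Recurrent links and the domain of the iterated boundary\<close>

context weighted_complex
begin

sublocale lkg: symmetric_graph lk b
  by (rule link_symmetric_graph)

text \<open>An isolated vertex of the link carries no flow. Otherwise the flow is restricted to the component,
  which does not change its divergence, as no edges leave the component.\<close>

lemma recurrent_component_balanced:
  assumes V: "V \<in> lkg.components" and rec: "recurrent_graph V b"
    and \<omega>: "\<omega> \<in> ell2 \<Sigma> m" and sum: "flow_div \<omega> summable_on lk"
  shows "infsum (flow_div \<omega>) V = 0"
proof (cases "\<exists>v. V = {v}")
  case True
  then obtain v where v: "V = {v}" by blast
  have "b v w = 0" if w: "w \<in> lk" for w
    using lkg.component_closed[OF V _ w, of v] lkg.no_loop[OF w] v by auto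
  then have "flow_div \<omega> v = 0" unfolding flow_div_def by (intro infsum_0) simp
  then show ?thesis using v by simp
next
  case False
  interpret W: weighted_graph V b by (rule lkg.component_weighted_graph[OF V False])
  have sub: "V \<subseteq> lk" by (rule lkg.component_subset[OF V])
  obtain y where y: "y \<in> V" using lkg.component_obtain[OF V] by blast
  have dvg: "W.divergence (flow \<omega>) x = flow_div \<omega> x" if x: "x \<in> V" for x
    unfolding W.divergence_def flow_div_def
    by (rule infsum_cong_neutral) (use sub lkg.component_closed[OF V x] in auto)
  have "infsum (W.divergence (flow \<omega>)) V = 0"
  proof (rule W.vanishing_avoidance_imp_flow_balanced[OF y])
    show "(\<lambda>n. avg V W.p (avoid V W.p y n) x) \<longlonglongrightarrow> 0" if "x \<in> V" for x
      using W.recurrent_graph_iff_avoidance_vanishes[OF False] rec that y by blast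
    show "flow \<omega> z x = - flow \<omega> x z" if "x \<in> V" "z \<in> V" for x z
      using that sub by (intro flow_antisym) auto
    show "(\<lambda>(x, z). b x z * (cmod (flow \<omega> x z))\<^sup>2) summable_on V \<times> V"
      by (rule summable_on_subset_banach[OF flow_energy[OF \<omega>]]) (use sub in auto)
    have "flow_div \<omega> summable_on V" by (rule summable_on_subset_banach[OF sum sub])
    then show "W.divergence (flow \<omega>) summable_on V"
      by (rule summable_on_cong[THEN iffD1, rotated]) (simp add: dvg)
  qed
  moreover have "infsum (W.divergence (flow \<omega>)) V = infsum (flow_div \<omega>) V"
    by (rule infsum_cong) (rule dvg)
  ultimately show ?thesis by simp
qed

text \<open>The divergence is absolutely summable over the link, so it may be summed component by component.\<close>

lemma recurrent_imp_boundary_boundary_zero: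
  assumes rec: "\<And>V. V \<in> lkg.components \<Longrightarrow> recurrent_graph V b"
    and \<omega>: "\<omega> \<in> dom_boundary2 \<Sigma> m \<delta>" "\<omega> \<in> ell2 \<Sigma> m"
  shows "bd (bd \<omega>) \<rho> = 0"
proof -
  have "(\<lambda>\<sigma>. m \<sigma> * cmod (bd \<omega> \<sigma>)) summable_on cofaces \<rho>"
    using \<omega>(1) \<rho> by (simp add: dom_boundary2_def dom_boundary_def)
  then have sum: "flow_div \<omega> summable_on lk" using boundary_summable_iff_div_summable by blast
  let ?S = "Sigma lkg.components (\<lambda>V. V)"
  have inj: "inj_on snd ?S"
  proof (rule inj_onI)
    fix s t assume "s \<in> ?S" "t \<in> ?S" "snd s = snd t"
    then obtain V V' v where st: "s = (V, v)" "t = (V', v)"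
      and V: "V \<in> lkg.components" "v \<in> V" and V': "V' \<in> lkg.components" "v \<in> V'"
      by (cases s, cases t) auto
    have "V = V'" by (rule trans[OF lkg.component_eq[OF V] lkg.component_eq[OF V', symmetric]])
    then show "s = t" using st by simp
  qed
  have "snd ` Sigma A (\<lambda>V. V) = \<Union>A" for A :: "'a set set" by force
  then have img: "snd ` ?S = lk" by (simp only: lkg.components_cover)
  have "(flow_div \<omega> has_sum infsum (flow_div \<omega>) lk) (snd ` ?S)"
    unfolding img by (rule has_sum_infsum[OF sum])
  then have tot: "(flow_div \<omega> \<circ> snd has_sum infsum (flow_div \<omega>) lk) ?S"
    using has_sum_reindex[OF inj] by blast
  have "((\<lambda>V. 0) has_sum infsum (flow_div \<omega>) lk) lkg.components"
  proof (rule has_sum_SigmaD[OF tot])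
    fix V assume V: "V \<in> lkg.components"
    have "flow_div \<omega> summable_on V"
      by (rule summable_on_subset_banach[OF sum lkg.component_subset[OF V]])
    then show "((\<lambda>v. (flow_div \<omega> \<circ> snd) (V, v)) has_sum 0) V"
      using recurrent_component_balanced[OF V rec[OF V] \<omega>(2) sum] by (simp add: has_sum_iff)
  qed
  then have "infsum (flow_div \<omega>) lk = 0" using has_sum_unique has_sum_0_simp by blast
  then show ?thesis using boundary_boundary_eq[of \<omega>] m_pos[OF \<rho>] by simp
qed

text \<open>The bound \<open>|\<omega>| \<le> 1 + |\<omega>|\<^sup>2\<close> and local summability of \<open>m\<close>.\<close>

lemma ell2_imp_dom_boundary:
  assumes \<omega>: "\<omega> \<in> ell2 \<Sigma> m"
  shows "\<omega> \<in> dom_boundary \<Sigma> m"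
  unfolding dom_boundary_def
proof (intro CollectI ballI)
  fix \<tau> assume \<tau>: "\<tau> \<in> \<Sigma>"
  have "(\<lambda>\<sigma>. m \<sigma> * (cmod (\<omega> \<sigma>))\<^sup>2) summable_on \<Sigma>" using \<omega> by (simp add: ell2_def)
  then have "(\<lambda>\<sigma>. m \<sigma> * (cmod (\<omega> \<sigma>))\<^sup>2) summable_on cofaces \<tau>"
    by (rule summable_on_subset_banach) auto
  then have "(\<lambda>\<sigma>. m \<sigma> + m \<sigma> * (cmod (\<omega> \<sigma>))\<^sup>2) summable_on cofaces \<tau>"
    by (rule summable_on_add[OF locally_summable[OF \<tau>]])
  then show "(\<lambda>\<sigma>. m \<sigma> * cmod (\<omega> \<sigma>)) summable_on cofaces \<tau>"
  proof (rule summable_on_comparison_test)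
    fix \<sigma> assume "\<sigma> \<in> cofaces \<tau>"
    then have m: "0 < m \<sigma>" using m_pos by simp
    then show "0 \<le> m \<sigma> * cmod (\<omega> \<sigma>)" by simp
    have "0 \<le> (cmod (\<omega> \<sigma>) - 1)\<^sup>2" by simp
    then have "2 * cmod (\<omega> \<sigma>) \<le> (cmod (\<omega> \<sigma>))\<^sup>2 + 1" by (simp add: power2_diff)
    then have "cmod (\<omega> \<sigma>) \<le> 1 + (cmod (\<omega> \<sigma>))\<^sup>2" using norm_ge_zero[of "\<omega> \<sigma>"] by linarith
    then have "m \<sigma> * cmod (\<omega> \<sigma>) \<le> m \<sigma> * (1 + (cmod (\<omega> \<sigma>))\<^sup>2)" using m by simp
    then show "m \<sigma> * cmod (\<omega> \<sigma>) \<le> m \<sigma> + m \<sigma> * (cmod (\<omega> \<sigma>))\<^sup>2" by (simp add: distrib_left)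
  qed
qed

definition supported_on_triangles :: "('a set \<Rightarrow> complex) \<Rightarrow> bool" where
  "supported_on_triangles \<omega> \<longleftrightarrow>
     (\<forall>\<tau>\<in>\<Sigma>. \<omega> \<tau> \<noteq> 0 \<longrightarrow> (\<exists>v\<in>lk. \<exists>w\<in>lk. adj v w \<and> \<tau> = triangle v w))"

text \<open>Let \<open>\<omega>\<close> live on simplices containing \<open>\<rho>\<close> with two more vertices. A coface of
  \<open>\<sigma> = \<rho>' \<union> {w}\<close> in its support contains \<open>\<rho> \<union> \<sigma>\<close>. It exists only if \<open>\<rho>'\<close> has as many
  vertices as \<open>\<rho>\<close>; as \<open>\<rho>' \<noteq> \<rho>\<close> and \<open>w \<notin> \<rho>\<close>, then \<open>\<rho>\<close> is not contained in \<open>\<sigma>\<close>, and the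
  coface is \<open>\<rho> \<union> \<sigma>\<close>. So at most one term of the sum defining the boundary at \<open>\<sigma>\<close> is nonzero.\<close>

lemma triangle_support_boundary_bound:
  assumes supp: "supported_on_triangles \<omega>"
    and \<rho>': "\<rho>' \<noteq> \<rho>" and w: "w \<notin> \<rho> \<union> \<rho>'" and \<sigma>: "insert w \<rho>' \<in> \<Sigma>"
    and nz: "bd \<omega> (insert w \<rho>') \<noteq> 0"
  shows "insert w (\<rho> \<union> \<rho>') \<in> \<Sigma>"
    and "m (insert w \<rho>') * cmod (bd \<omega> (insert w \<rho>'))
           \<le> m (insert w (\<rho> \<union> \<rho>')) * cmod (\<omega> (insert w (\<rho> \<union> \<rho>')))"
proof -
  let ?\<sigma> = "insert w \<rho>'" and ?\<kappa> = "insert w (\<rho> \<union> \<rho>')"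
  let ?f = "\<lambda>\<tau>. of_real (m \<tau>) * \<theta> ?\<sigma> \<tau> * \<omega> \<tau>"
  have only: "\<tau> = ?\<kappa>" if \<tau>: "\<tau> \<in> \<Sigma>" "is_face ?\<sigma> \<tau>" "\<omega> \<tau> \<noteq> 0" for \<tau>
  proof -
    obtain x y where xy: "x \<in> lk" "y \<in> lk" "adj x y" "\<tau> = triangle x y"
      using supp \<tau> unfolding supported_on_triangles_def by blast
    obtain a where a: "a \<notin> ?\<sigma>" "\<tau> = insert a ?\<sigma>" using \<tau>(2) unfolding is_face_iff by blast
    have fin: "finite \<rho>" "finite \<rho>'"
      using finite_simplex[OF \<rho>] finite_simplex[OF \<sigma>] by auto
    have card_\<tau>: "card \<tau> = card \<rho> + 2"
      using xy fin unfolding lk_def adj_def by auto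
    have "card \<tau> = card \<rho>' + 2" using a w fin by auto
    then have card_eq: "card \<rho> = card \<rho>'" using card_\<tau> by simp
    have "a \<in> \<rho>"
    proof (rule ccontr)
      assume "a \<notin> \<rho>"
      moreover have "\<rho> \<subseteq> insert a (insert w \<rho>')" unfolding a(2)[symmetric] xy(4) by blast
      ultimately have "\<rho> \<subseteq> \<rho>'" using w by blast
      then show False using card_subset_eq[OF fin(2)] card_eq \<rho>' by blast
    qed
    moreover have "\<rho> \<subseteq> \<tau>" using xy(4) by blast
    ultimately show "\<tau> = ?\<kappa>" using a(2) by blast
  qed
  have eq: "of_real (m ?\<sigma>) * bd \<omega> ?\<sigma> = infsum ?f (cofaces ?\<sigma>)"
    using m_pos[OF \<sigma>] by (simp add: boundary_def)
  have "infsum ?f (cofaces ?\<sigma>) \<noteq> 0" using nz m_pos[OF \<sigma>] unfolding eq[symmetric] by simp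
  then have "\<not> (\<forall>\<tau>\<in>cofaces ?\<sigma>. ?f \<tau> = 0)" using infsum_0[of "cofaces ?\<sigma>" ?f] by fastforce
  then obtain \<tau> where "\<tau> \<in> cofaces ?\<sigma>" "?f \<tau> \<noteq> 0" by blast
  then have \<kappa>: "?\<kappa> \<in> \<Sigma>" "is_face ?\<sigma> ?\<kappa>" using only[of \<tau>] by auto
  show "?\<kappa> \<in> \<Sigma>" by (rule \<kappa>(1))
  note eq
  also have "infsum ?f (cofaces ?\<sigma>) = infsum ?f {?\<kappa>}"
  proof (rule infsum_cong_neutral)
    show "?f \<tau> = 0" if "\<tau> \<in> cofaces ?\<sigma> - {?\<kappa>}" for \<tau>
      using only[of \<tau>] that by fastforce
    show "?f \<tau> = 0" if "\<tau> \<in> {?\<kappa>} - cofaces ?\<sigma>" for \<tau>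
      using \<kappa> that by blast
  qed simp
  also have "\<dots> = ?f ?\<kappa>" by simp
  finally have "of_real (m ?\<sigma>) * bd \<omega> ?\<sigma> = ?f ?\<kappa>" .
  then have "cmod (of_real (m ?\<sigma>) * bd \<omega> ?\<sigma>) = cmod (?f ?\<kappa>)" by (simp only:)
  then show "m ?\<sigma> * cmod (bd \<omega> ?\<sigma>) \<le> m ?\<kappa> * cmod (\<omega> ?\<kappa>)"
    using m_pos[OF \<sigma>] m_pos[OF \<kappa>(1)] cmod_\<theta>[OF \<sigma> \<kappa>] by (simp add: norm_mult)
qed

text \<open>At \<open>\<rho>\<close> itself, summability of the boundary is summability of the divergence. At any other simplex
  \<open>\<rho>'\<close>, all but finitely many cofaces \<open>\<rho>' \<union> {w}\<close> have \<open>w \<notin> \<rho>\<close>, and for these the preceding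
  bound injects the sum into the sum of \<open>m |\<omega>|\<close> over the cofaces of \<open>\<rho> \<union> \<rho>'\<close>.\<close>

lemma triangle_support_dom_boundary2:
  assumes dom: "\<omega> \<in> dom_boundary \<Sigma> m" and supp: "supported_on_triangles \<omega>"
    and sum: "flow_div \<omega> summable_on lk"
  shows "\<omega> \<in> dom_boundary2 \<Sigma> m \<delta>"
proof -
  have "(\<lambda>\<sigma>. m \<sigma> * cmod (bd \<omega> \<sigma>)) summable_on cofaces \<rho>'" if \<rho>': "\<rho>' \<in> \<Sigma>" "\<rho>' \<noteq> \<rho>" for \<rho>'
  proof -
    let ?F = "\<lambda>\<sigma>. m \<sigma> * cmod (bd \<omega> \<sigma>)"
    \<comment> \<open>The cofaces \<open>insert w \<rho>'\<close> with \<open>w \<in> ?W\<close> are controlled by the bound, those in \<open>?D\<close> are finite in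
      number, and the function vanishes at all others.\<close>
    let ?W = "{w. w \<notin> \<rho> \<union> \<rho>' \<and> insert w \<rho>' \<in> \<Sigma> \<and> bd \<omega> (insert w \<rho>') \<noteq> 0}"
    let ?D = "{\<sigma>\<in>cofaces \<rho>'. \<sigma> \<subseteq> \<rho> \<union> \<rho>'}"
    note bound = triangle_support_boundary_bound[OF supp \<rho>'(2)]
    have "(\<lambda>w. ?F (insert w \<rho>')) summable_on ?W"
    proof (cases "?W = {}")
      case False
      then obtain w where "w \<in> ?W" by blast
      then have "insert w (\<rho> \<union> \<rho>') \<in> \<Sigma>" using bound(1) by blast
      then have "\<rho> \<union> \<rho>' \<in> \<Sigma>" by (rule interval_closed[OF \<rho>]) auto
      then have "(\<lambda>\<tau>. m \<tau> * cmod (\<omega> \<tau>)) summable_on cofaces (\<rho> \<union> \<rho>')"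
        using dom by (simp add: dom_boundary_def)
      then have "(\<lambda>\<tau>. m \<tau> * cmod (\<omega> \<tau>)) summable_on (\<lambda>w. insert w (\<rho> \<union> \<rho>')) ` ?W"
        by (rule summable_on_subset_banach) (use bound(1) in \<open>auto simp: is_face_iff\<close>)
      moreover have "inj_on (\<lambda>w. insert w (\<rho> \<union> \<rho>')) ?W" unfolding inj_on_def by blast
      ultimately have "((\<lambda>\<tau>. m \<tau> * cmod (\<omega> \<tau>)) \<circ> (\<lambda>w. insert w (\<rho> \<union> \<rho>'))) summable_on ?W"
        using summable_on_reindex by blast
      then show ?thesis
      proof (rule summable_on_comparison_test)
        fix w assume w: "w \<in> ?W"
        then show "0 \<le> ?F (insert w \<rho>')" using m_pos by (simp add: less_imp_le)
        show "?F (insert w \<rho>') \<le> ((\<lambda>\<tau>. m \<tau> * cmod (\<omega> \<tau>)) \<circ> (\<lambda>w. insert w (\<rho> \<union> \<rho>'))) w"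
          using bound(2)[of w] w by simp
      qed
    qed (simp only:, simp)
    moreover have "inj_on (\<lambda>w. insert w \<rho>') ?W" unfolding inj_on_def by blast
    ultimately have "?F summable_on (\<lambda>w. insert w \<rho>') ` ?W"
      using summable_on_reindex[of "\<lambda>w. insert w \<rho>'" ?W ?F] by (simp add: o_def)
    moreover have "?F summable_on ?D"
    proof (rule summable_on_finite)
      have "finite (\<rho> \<union> \<rho>')" using finite_simplex \<rho> \<rho>' by blast
      then show "finite ?D" by (intro finite_subset[of ?D "Pow (\<rho> \<union> \<rho>')"]) auto
    qed
    ultimately have "?F summable_on ((\<lambda>w. insert w \<rho>') ` ?W \<union> ?D)"
      by (intro summable_on_union)
    then show ?thesis
    proof (rule summable_on_cong_neutral[THEN iffD1, rotated -1])
      fix \<sigma> assume "\<sigma> \<in> cofaces \<rho>' - ((\<lambda>w. insert w \<rho>') ` ?W \<union> ?D)"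
      then show "?F \<sigma> = 0" unfolding is_face_iff by auto
    next
      fix \<sigma> assume "\<sigma> \<in> ((\<lambda>w. insert w \<rho>') ` ?W \<union> ?D) - cofaces \<rho>'"
      then show "?F \<sigma> = 0" by (auto simp: is_face_iff)
    qed simp
  qed
  moreover have "(\<lambda>\<sigma>. m \<sigma> * cmod (bd \<omega> \<sigma>)) summable_on cofaces \<rho>"
    using sum boundary_summable_iff_div_summable by blast
  ultimately have "bd \<omega> \<in> dom_boundary \<Sigma> m" unfolding dom_boundary_def by blast
  then show ?thesis using dom by (simp add: dom_boundary2_def)
qed

end

section \<open>Potentials on transient links\<close>

context weighted_complex
begin

text \<open>The function \<open>\<eta>\<close> on the cofaces of \<open>\<rho>\<close> whose coboundary has the gradient of \<open>q\<close> as its flow;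
  \<open>the_elem (\<sigma> - \<rho>)\<close> is the vertex \<open>v\<close> with \<open>\<sigma> = v\<rho>\<close>.\<close>

definition cone :: "('a \<Rightarrow> real) \<Rightarrow> 'a set \<Rightarrow> complex" where
  "cone q \<sigma> = (if is_face \<rho> \<sigma> then \<theta> \<rho> \<sigma> * of_real (q (the_elem (\<sigma> - \<rho>))) else 0)"

lemma cone_lk:
  assumes "v \<in> lk"
  shows "cone q (insert v \<rho>) = \<theta> \<rho> (insert v \<rho>) * of_real (q v)"
proof -
  have "insert v \<rho> - \<rho> = {v}" using assms by (auto simp: lk_def)
  then show ?thesis using lk_face[OF assms] by (simp add: cone_def)
qed

lemma flow_\<delta>_cone:
  assumes v: "v \<in> lk" and w: "w \<in> lk" and vw: "adj v w"
  shows "flow (\<delta> (cone q)) v w = of_real (q v - q w)"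
proof -
  let ?T = "triangle v w" and ?v = "insert v \<rho>" and ?w = "insert w \<rho>"
  have T: "?T \<in> \<Sigma>" using vw by (simp add: adj_def)
  have "\<delta> (cone q) ?T = \<theta> ?v ?T * cone q ?v + \<theta> ?w ?T * cone q ?w"
    unfolding \<delta>_eq[OF T] by (rule sum_faces_triangle[OF v w vw]) (simp add: cone_def)
  also have "\<dots> = \<theta> \<rho> ?v * \<theta> ?v ?T * of_real (q v) + \<theta> \<rho> ?w * \<theta> ?w ?T * of_real (q w)"
    unfolding cone_lk[OF v] cone_lk[OF w] by (simp add: mult_ac)
  also have "\<dots> = \<theta> \<rho> ?v * \<theta> ?v ?T * of_real (q v - q w)"
    unfolding \<theta>_antisym[OF v w vw] by (simp add: algebra_simps)
  finally have "flow (\<delta> (cone q)) v w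
      = (\<theta> \<rho> ?v * \<theta> \<rho> ?v) * (\<theta> ?v ?T * \<theta> ?v ?T) * of_real (q v - q w)"
    using vw by (simp add: flow_def mult_ac)
  then show ?thesis
    using \<theta>_square[OF \<rho>] \<theta>_square[of ?v ?T] lk_face[OF v] lk_triangle_face[OF v w vw] by simp
qed

lemma \<delta>_cone_supported: "supported_on_triangles (\<delta> (cone q))"
  unfolding supported_on_triangles_def
proof (intro ballI impI)
  fix \<tau> assume \<tau>: "\<tau> \<in> \<Sigma>" and "\<delta> (cone q) \<tau> \<noteq> 0"
  then obtain \<kappa> where \<kappa>: "\<kappa> \<in> \<Sigma>" "is_face \<kappa> \<tau>" "cone q \<kappa> \<noteq> 0"
    unfolding \<delta>_eq[OF \<tau>] by (auto elim: sum.not_neutral_contains_not_neutral)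
  then have "is_face \<rho> \<kappa>" by (simp add: cone_def split: if_splits)
  then obtain v where v: "v \<notin> \<rho>" "\<kappa> = insert v \<rho>" unfolding is_face_iff by blast
  obtain w where w: "w \<notin> \<kappa>" "\<tau> = insert w \<kappa>" using \<kappa>(2) unfolding is_face_iff by blast
  have "insert w \<rho> \<in> \<Sigma>" by (rule interval_closed[OF \<rho> \<tau>]) (use v w in auto)
  then have "w \<in> lk" "v \<in> lk" "adj w v" "\<tau> = triangle w v"
    using v w \<kappa> \<tau> by (auto simp: lk_def adj_def)
  then show "\<exists>v\<in>lk. \<exists>w\<in>lk. adj v w \<and> \<tau> = triangle v w" by blast
qed

text \<open>The energy of \<open>q\<close> counts each simplex \<open>vw\<rho>\<close> at least once.\<close>

lemma \<delta>_cone_ell2: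
  assumes energy: "(\<lambda>(v, w). b v w * (q v - q w)\<^sup>2) summable_on lk \<times> lk"
  shows "\<delta> (cone q) \<in> ell2 \<Sigma> m"
proof -
  let ?\<omega> = "\<delta> (cone q)"
  let ?A = "{(v, w). v \<in> lk \<and> w \<in> lk \<and> adj v w}" and ?g = "\<lambda>(v, w). triangle v w"
  let ?F = "\<lambda>\<tau>. m \<tau> * (cmod (?\<omega> \<tau>))\<^sup>2"
  have "?F (triangle v w) = b v w * (q v - q w)\<^sup>2" if vw: "v \<in> lk" "w \<in> lk" "adj v w" for v w
  proof -
    have "cmod (flow ?\<omega> v w) = cmod (?\<omega> (triangle v w))"
      using vw lk_face[OF vw(1)] lk_triangle_face[OF vw] cmod_\<theta> \<rho> by (simp add: flow_def norm_mult)
    then have "cmod (?\<omega> (triangle v w)) = \<bar>q v - q w\<bar>"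
      unfolding flow_\<delta>_cone[OF vw] by (simp only: norm_of_real)
    then show ?thesis using vw(3) by (simp add: b_eq)
  qed
  moreover have "(\<lambda>(v, w). b v w * (q v - q w)\<^sup>2) summable_on ?A"
    by (rule summable_on_subset_banach[OF energy]) auto
  ultimately have "(\<lambda>u. ?F (?g u)) summable_on ?A"
    by (subst summable_on_cong[where g = "\<lambda>(v, w). b v w * (q v - q w)\<^sup>2"]) auto
  then have "?F summable_on ?g ` ?A" by (rule summable_on_image)
  then have "?F summable_on \<Sigma>"
  proof (rule summable_on_cong_neutral[THEN iffD1, rotated -1])
    show "?F \<tau> = 0" if "\<tau> \<in> ?g ` ?A - \<Sigma>" for \<tau> using that by (auto simp: adj_def)
    show "?F \<tau> = 0" if \<tau>: "\<tau> \<in> \<Sigma> - ?g ` ?A" for \<tau>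
    proof (rule ccontr)
      assume "?F \<tau> \<noteq> 0"
      then have "?\<omega> \<tau> \<noteq> 0" by auto
      then obtain v w where "v \<in> lk" "w \<in> lk" "adj v w" "\<tau> = triangle v w"
        using \<delta>_cone_supported[of q] \<tau> unfolding supported_on_triangles_def by blast
      then have "\<tau> \<in> ?g ` ?A" by (intro image_eqI[of _ _ "(v, w)"]) auto
      then show False using \<tau> by blast
    qed
  qed simp
  then show ?thesis by (simp add: ell2_def)
qed

text \<open>The flow of \<open>\<delta>\<eta>\<close> is the gradient of \<open>q\<close>, whose total divergence is \<open>c\<close>.\<close>

lemma potential_imp_boundary_boundary_nonzero:
  assumes y: "y \<in> lk" and c: "c \<noteq> 0"
    and energy: "(\<lambda>(v, w). b v w * (q v - q w)\<^sup>2) summable_on lk \<times> lk"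
    and dvg: "\<And>v. v \<in> lk \<Longrightarrow> ((\<lambda>w. b v w * (q v - q w)) has_sum (if v = y then c else 0)) lk"
  shows "\<exists>\<omega>\<in>dom_boundary2 \<Sigma> m \<delta> \<inter> ell2 \<Sigma> m. bd (bd \<omega>) \<rho> \<noteq> 0"
proof -
  let ?\<omega> = "\<delta> (cone q)"
  have flow_div_eq: "flow_div ?\<omega> v = of_real (if v = y then c else 0)" if v: "v \<in> lk" for v
  proof -
    have "flow_div ?\<omega> v = (\<Sum>\<^sub>\<infinity>w\<in>lk. of_real (b v w * (q v - q w)))"
      unfolding flow_div_def
      by (rule infsum_cong) (use flow_\<delta>_cone[OF v] in \<open>simp add: b_eq\<close>)
    also have "\<dots> = of_real (if v = y then c else 0)"
      by (rule infsumI[OF has_sum_of_real[OF dvg[OF v]]])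
    finally show ?thesis .
  qed
  have "((\<lambda>v. of_real (if v = y then c else 0) :: complex) has_sum of_real c) lk"
    by (rule has_sum_finite_neutralI[of "{y}"]) (use y in auto)
  then have total: "(flow_div ?\<omega> has_sum of_real c) lk"
    by (rule has_sum_cong[THEN iffD1, rotated]) (simp add: flow_div_eq)
  have ell2: "?\<omega> \<in> ell2 \<Sigma> m" by (rule \<delta>_cone_ell2[OF energy])
  moreover have "?\<omega> \<in> dom_boundary2 \<Sigma> m \<delta>"
    using ell2_imp_dom_boundary[OF ell2] \<delta>_cone_supported has_sum_imp_summable[OF total]
    by (rule triangle_support_dom_boundary2)
  moreover have "bd (bd ?\<omega>) \<rho> \<noteq> 0"
    using boundary_boundary_eq[of ?\<omega>] infsumI[OF total] c by auto
  ultimately show ?thesis by blast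
qed

text \<open>The potential on the transient component is extended by zero to the whole link. This creates
  no energy, as no edges join the component to its complement.\<close>

lemma transient_component_imp_boundary_boundary_nonzero:
  assumes V: "V \<in> lkg.components" and transient: "\<not> recurrent_graph V b"
  shows "\<exists>\<omega>\<in>dom_boundary2 \<Sigma> m \<delta> \<inter> ell2 \<Sigma> m. bd (bd \<omega>) \<rho> \<noteq> 0"
proof -
  have nontrivial: "\<nexists>v. V = {v}" using transient unfolding recurrent_graph_def by blast
  interpret W: weighted_graph V b by (rule lkg.component_weighted_graph[OF V nontrivial])
  have sub: "V \<subseteq> lk" by (rule lkg.component_subset[OF V])
  obtain x y where xy: "x \<in> V" "y \<in> V" "\<not> (\<lambda>n. avg V W.p (avoid V W.p y n) x) \<longlonglongrightarrow> 0"
    using transient W.recurrent_graph_iff_avoidance_vanishes[OF nontrivial] by blast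
  obtain q c where c: "c \<noteq> 0"
    and energy: "(\<lambda>(x, z). b x z * (q x - q z)\<^sup>2) summable_on V \<times> V"
    and dvg: "\<And>x. x \<in> V \<Longrightarrow> ((\<lambda>z. b x z * (q x - q z)) has_sum (if x = y then c else 0)) V"
    by (rule W.persistent_avoidance_imp_potential[OF xy]) (rule that)
  define Q where "Q v = (if v \<in> V then q v else 0)" for v
  have cross: "b v w = 0" if "v \<in> lk" "w \<in> lk" "(v \<in> V) \<noteq> (w \<in> V)" for v w
    using that lkg.component_closed[OF V, of v w] lkg.component_closed[OF V, of w v] lkg.sym[of v w] by auto
  show ?thesis
  proof (rule potential_imp_boundary_boundary_nonzero[of y c Q])
    show "y \<in> lk" using xy(2) sub by blast
    show "c \<noteq> 0" by (rule c)
    show "(\<lambda>(v, w). b v w * (Q v - Q w)\<^sup>2) summable_on lk \<times> lk"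
      using energy
    proof (rule summable_on_cong_neutral[THEN iffD1, rotated -1])
      fix u assume "u \<in> V \<times> V - lk \<times> lk"
      then show "(case u of (x, z) \<Rightarrow> b x z * (q x - q z)\<^sup>2) = 0" using sub by auto
    next
      fix u assume "u \<in> lk \<times> lk - V \<times> V"
      then obtain v w where u: "u = (v, w)" "v \<in> lk" "w \<in> lk" "\<not> (v \<in> V \<and> w \<in> V)" by auto
      then have "b v w = 0 \<or> Q v - Q w = 0"
        using cross[OF u(2,3)] by (auto simp: Q_def)
      then show "(case u of (v, w) \<Rightarrow> b v w * (Q v - Q w)\<^sup>2) = 0" unfolding u(1) by auto
    qed (auto simp: Q_def)
    show "((\<lambda>w. b v w * (Q v - Q w)) has_sum (if v = y then c else 0)) lk" if v: "v \<in> lk" for v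
    proof (cases "v \<in> V")
      case True
      from dvg[OF True] show ?thesis
        by (rule has_sum_cong_neutral[THEN iffD1, rotated -1])
           (use True sub cross[OF v] in \<open>auto simp: Q_def\<close>)
    next
      case False
      then have "b v w * (Q v - Q w) = 0" if "w \<in> lk" for w
        using cross[OF v that] by (auto simp: Q_def)
      moreover have "v \<noteq> y" using False xy(2) by blast
      ultimately show ?thesis by (simp add: has_sum_0)
    qed
  qed
qed

theorem boundary_boundary_zero_iff_recurrent:
  "(\<forall>\<omega>\<in>dom_boundary2 \<Sigma> m \<delta> \<inter> ell2 \<Sigma> m. bd (bd \<omega>) \<rho> = 0)
    \<longleftrightarrow> (\<forall>V\<in>connected_components_of_graph {v. v \<notin> \<rho> \<and> insert v \<rho> \<in> \<Sigma>} b. recurrent_graph V b)"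
  unfolding lk_def[symmetric]
proof (intro iffI ballI)
  fix V assume "\<forall>\<omega>\<in>dom_boundary2 \<Sigma> m \<delta> \<inter> ell2 \<Sigma> m. bd (bd \<omega>) \<rho> = 0" "V \<in> lkg.components"
  then show "recurrent_graph V b"
    using transient_component_imp_boundary_boundary_nonzero[of V] by blast
next
  fix \<omega> assume "\<forall>V\<in>lkg.components. recurrent_graph V b" "\<omega> \<in> dom_boundary2 \<Sigma> m \<delta> \<inter> ell2 \<Sigma> m"
  then show "bd (bd \<omega>) \<rho> = 0" by (intro recurrent_imp_boundary_boundary_zero) auto
qed

end

section \<open>The characterisation\<close>

text \<open>The lower end of the interval decides whether the empty simplex may occur.\<close>

lemma simplices_interval_closed:
  assumes S: "simplicial_complex X S" and \<tau>: "\<tau> \<in> simplices X S m" and \<sigma>: "\<sigma> \<in> simplices X S m"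
    and "\<tau> \<subseteq> \<kappa>" "\<kappa> \<subseteq> \<sigma>"
  shows "\<kappa> \<in> simplices X S m"
proof -
  have "\<sigma> \<in> S" using \<sigma> by (auto simp: simplices_def split: if_splits)
  then have "\<kappa> \<in> S" using S \<open>\<kappa> \<subseteq> \<sigma>\<close> unfolding simplicial_complex_def by blast
  then show ?thesis using \<tau> \<open>\<tau> \<subseteq> \<kappa>\<close> by (auto simp: simplices_def split: if_splits)
qed

theorem theorem4p1:
  fixes X :: "'a set" and S :: "'a set set" and m :: "'a set \<Rightarrow> real"
    and \<delta> :: "('a set \<Rightarrow> complex) \<Rightarrow> 'a set \<Rightarrow> complex"
    and \<Sigma> :: "'a set set" and \<rho> :: "'a set"
  assumes "weighted_simplicial_complex X S m"
    and "\<Sigma> = simplices X S m"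
    and "coboundary_operator \<Sigma> \<delta>"
    and "\<rho> \<in> \<Sigma>"
  shows "(\<forall>\<omega> \<in> dom_boundary2 \<Sigma> m \<delta> \<inter> ell2 \<Sigma> m.
            boundary \<Sigma> m \<delta> (boundary \<Sigma> m \<delta> \<omega>) \<rho> = 0)
     \<longleftrightarrow> (\<forall>V \<in> connected_components_of_graph (link X \<Sigma> \<rho>) (link_graph \<Sigma> m \<rho>).
            recurrent_graph V (link_graph \<Sigma> m \<rho>))"
proof -
  have S: "simplicial_complex X S"
    using assms(1) unfolding weighted_simplicial_complex_def by blast
  have sub: "\<Sigma> \<subseteq> S" unfolding assms(2) simplices_def by auto
  have locsum: "\<forall>\<tau>\<in>\<Sigma>. m summable_on {\<sigma>\<in>\<Sigma>. is_face \<tau> \<sigma>}"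
    using assms(1) unfolding weighted_simplicial_complex_def assms(2)[symmetric] by (elim conjE)
  have "weighted_complex \<Sigma> m \<delta> \<rho>"
  proof
    show "finite \<sigma>" if "\<sigma> \<in> \<Sigma>" for \<sigma>
      using that sub S unfolding simplicial_complex_def by blast
    show "0 < m \<sigma>" if "\<sigma> \<in> \<Sigma>" for \<sigma>
      using that sub assms(1) unfolding weighted_simplicial_complex_def by blast
    show "\<kappa> \<in> \<Sigma>" if "\<tau> \<in> \<Sigma>" "\<sigma> \<in> \<Sigma>" "\<tau> \<subseteq> \<kappa>" "\<kappa> \<subseteq> \<sigma>" for \<tau> \<sigma> \<kappa>
      using simplices_interval_closed[OF S] that unfolding assms(2) by blast
    show "m summable_on {\<sigma>\<in>\<Sigma>. is_face \<tau> \<sigma>}" if "\<tau> \<in> \<Sigma>" for \<tau>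
      by (rule bspec[OF locsum that])
    show "coboundary_operator \<Sigma> \<delta>" by (rule assms(3))
    show "\<rho> \<in> \<Sigma>" by (rule assms(4))
  qed
  note iff = weighted_complex.boundary_boundary_zero_iff_recurrent[OF this]
  have "v \<in> X" if "insert v \<rho> \<in> \<Sigma>" for v
  proof -
    have "insert v \<rho> \<in> S" using that sub by blast
    moreover have "\<forall>\<sigma>\<in>S. \<forall>\<tau>. \<tau> \<subseteq> \<sigma> \<longrightarrow> \<tau> \<in> S" and X: "{x. {x} \<in> S} = X"
      using S unfolding simplicial_complex_def by simp_all
    ultimately have "{v} \<in> S" by simp
    then show ?thesis using X by blast
  qed
  then have "link X \<Sigma> \<rho> = {v. v \<notin> \<rho> \<and> insert v \<rho> \<in> \<Sigma>}"
    unfolding link_def by (auto simp: is_face_insert)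
  then show ?thesis using iff by (simp only:)
qed

end
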